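(* Let $(X,\mathcal{A})$ be a measurable space with a $\sigma$-algebra, let $\mathbb{V},\mathbb{V}',\mathbb{W}$ be Banach spaces over $\mathbb{F}\in\{\mathbb{R},\mathbb{C}\}$, and let $\mu:\mathcal{A}\to L(\mathbb{V},\mathbb{W})$ be a measure countably additive in the operator norm with finite semivariation $\widehat{\mu}$. Let $M:\mathcal{A}\to L[L(\mathbb{V}',\mathbb{V}),L(\mathbb{V}',\mathbb{W})]$ be given by $M(A)[B]=\mu(A)\circ B$, let $g:X\to L(\mathbb{V}',\mathbb{V})$ be Dobrakov integrable with respect to $M$, and let $\gamma\in\mathrm{CA}[\mathcal{A},L(\mathbb{V}',\mathbb{W})]$, $\gamma(A)=\int_Ag\,dM$. Let $f\in\mathcal{SM}(\widehat{\mu},\mathbb{V}')$ and $1\le p<\infty$. Then: (a) for every $A\in\mathcal{A}$: $\displaystyle\widehat{\gamma}_p(f,A)=\sup\Big\{\Big\|\int_Ag[s]\,d\mu\Big\|_{\mathbb{W}}^{1/p}: s\in\mathcal{S}(\mathcal{A},\mathbb{V}'),\ |s|\le|f|^p\Big\}$; (b) $\widehat{\gamma}_p(f,\cdot)\le\widehat{\mu}_1(|g||f|^p,\cdot)^{1/p}$ on $\mathcal{A}$; (c) if $|g||f|\in\mathcal{L}_1(\mu,[0,\infty])$, then $f\in\mathcal{L}_1(\gamma,\mathbb{V}')$ and $\displaystyle\int_Af\,d\gamma=\int_Agf\,d\mu$ for every $A\in\mathcal{A}$.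
   Context: $L(E,G)$: bounded linear operators with operator norm. $\mathrm{CA}[\mathcal{A},Y]$: $Y$-valued measures on $\mathcal{A}$ countably additive in norm. For a vector- or operator-valued function, $|f|(x)=\|f(x)\|$; $g[s]$ and $gf$ denote $x\mapsto g(x)[s(x)]$ and $x\mapsto g(x)[f(x)]$. For Banach spaces $E,G$ and $m\in\mathrm{CA}[\mathcal{A},L(E,G)]$: Semivariation: $\widehat{m}(A)=\sup\{\|\sum_{i=1}^nm(A_i)v_i\|_G:A_i\in\mathcal{A}\text{ disjoint, finitely many, contained in }A,\ \|v_i\|_E\le1\}$. "$m$-a.e." means outside a subset of some $N\in\mathcal{A}$ with $\widehat{m}(N)=0$. (For the measure $M$ above one has $\widehat{M}=\widehat{\mu}$ whenever $\mathbb{V}'\neq0$, so $M$ has finite semivariation.) $\mathcal{S}(\mathcal{A},E)$: $\mathcal{A}$-measurable $E$-valued functions with finitely many values. $\mathcal{SM}(m,E)=\mathcal{SM}(\widehat{m},E)$ (resp. $\mathcal{SM}(m,[0,\infty])$): functions $X\to E$ (resp. $X\to[0,\infty]$) that are $m$-a.e. limits of sequences of $E$-valued (resp. real-valued) simple functions. For another Banach space $E'$, $\mathcal{SM}(\widehat{m},E')$ is the set of $m$-a.e. limits of sequences in $\mathcal{S}(\mathcal{A},E')$. Dobrakov integral: for simple $s=\sum_i\chi_{A_i}v_i$ ($A_i\in\mathcal A$ disjoint), $\int_As\,dm=\sum_im(A\cap A_i)v_i\in G$. $f:X\to E$ is integrable if there are $s_n\in\mathcal{S}(\mathcal{A},E)$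 with $s_n\to f$ $m$-a.e. such that $\lim_n\int_As_n\,dm$ exists for every $A\in\mathcal{A}$; then $\int_Af\,dm$ is this limit (independent of the sequence). Dobrakov $p$-semivariation ($1\le p<\infty$): $\widehat{m}_p(f,A)=\sup\{\|\int_As\,dm\|_G^{1/p}:s\in\mathcal{S}(\mathcal{A},E),\ \|s(\cdot)\|\le f^p\}$ for $[0,\infty]$-valued $f$, and $\widehat{m}_p(f,A)=\widehat{m}_p(|f|,A)$ for $E$-valued $f$. $\mathcal{L}_p(m,Y)$ ($Y=E$ or $[0,\infty]$) is the set of $f\in\mathcal{SM}(m,Y)$ such that $\widehat{m}_p(f,A_n)\to0$ whenever $A_n\in\mathcal{A}$, $A_n\searrow\varnothing$. These definitions are applied to $\gamma$ with $E=\mathbb{V}'$, $G=\mathbb{W}$. The functions $g[s]$, $s\in\mathcal{S}(\mathcal{A},\mathbb{V}')$, are $\mu$-integrable. *)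

theory Defs
  imports "HOL-Analysis.Analysis"
begin

section \<open>Scalar fields and operator spaces\<close>

text \<open>
  To treat real and complex scalars together, the scalar field is a set \<open>F\<close> of complex numbers,
  either \<open>\<real>\<close> or \<open>UNIV\<close>. A Banach space over \<open>F\<close> is a type of class \<^class>\<open>banach\<close> with a scalar
  multiplication by elements of \<open>F\<close> that extends \<open>(*\<^sub>R)\<close>; nothing is assumed about \<open>sc a\<close> for
  \<open>a \<notin> F\<close>.
\<close>

definition banach_over :: "complex set \<Rightarrow> (complex \<Rightarrow> 'v::banach \<Rightarrow> 'v) \<Rightarrow> bool" where
  "banach_over F sc \<longleftrightarrow>
     (\<forall>a\<in>F. \<forall>x y. sc a (x + y) = sc a x + sc a y) \<and>
     (\<forall>a\<in>F. \<forall>b\<in>F. \<forall>x. sc (a + b) x = sc a x + sc b x) \<and>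
     (\<forall>a\<in>F. \<forall>b\<in>F. \<forall>x. sc (a * b) x = sc a (sc b x)) \<and>
     (\<forall>r x. sc (complex_of_real r) x = r *\<^sub>R x) \<and>
     (\<forall>a\<in>F. \<forall>x. norm (sc a x) = cmod a * norm x)"

text \<open>
  The space \<open>L(V,W)\<close> of bounded \<open>F\<close>-linear operators, as a subspace of the bounded real-linear
  ones. For \<open>F = \<real>\<close> it is everything.
\<close>

definition lin_ops ::
  "complex set \<Rightarrow> (complex \<Rightarrow> 'v::banach \<Rightarrow> 'v) \<Rightarrow> (complex \<Rightarrow> 'w::banach \<Rightarrow> 'w) \<Rightarrow> ('v \<Rightarrow>\<^sub>L 'w) set"
  where "lin_ops F scV scW =
    {T. \<forall>a\<in>F. \<forall>x. blinfun_apply T (scV a x) = scW a (blinfun_apply T x)}"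

lemma lin_ops_real:
  assumes "banach_over \<real> scV" "banach_over \<real> scW"
  shows "lin_ops \<real> scV scW = UNIV"
  using assms by (auto simp: lin_ops_def banach_over_def Reals_def blinfun.scaleR_right)


section \<open>Operator-valued measures\<close>

text \<open>
  Throughout, a value \<open>X\<close> of type \<^typ>\<open>'x measure\<close> only serves as a measurable space
  \<open>(space X, sets X)\<close>. The parameter \<open>E\<close> is the Banach space of the integrands, given as a closed
  subspace of its type: \<open>UNIV\<close> for a whole type, and \<open>lin_ops F _ _\<close> for an operator space.
  The operators \<open>m A\<close> are applied to elements of \<open>E\<close> only.
\<close>

definition CA :: "'x measure \<Rightarrow> 'y::real_normed_vector set \<Rightarrow> ('x set \<Rightarrow> 'y) set" where
  "CA X Y = {m. (\<forall>A\<in>sets X. m A \<in> Y) \<and>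
     (\<forall>A::nat \<Rightarrow> 'x set. range A \<subseteq> sets X \<longrightarrow> disjoint_family A \<longrightarrow>
        (\<lambda>n. m (A n)) sums m (\<Union>n. A n))}"

definition semivariation ::
  "'x measure \<Rightarrow> 'e::banach set \<Rightarrow> ('x set \<Rightarrow> 'e \<Rightarrow>\<^sub>L 'g::banach) \<Rightarrow> 'x set \<Rightarrow> ennreal" where
  "semivariation X E m A =
     Sup {ennreal (norm (\<Sum>i<n. blinfun_apply (m (B i)) (v i))) | (n::nat) B v.
        (\<forall>i<n. B i \<in> sets X \<and> B i \<subseteq> A) \<and> disjoint_family_on B {..<n} \<and>
        (\<forall>i<n. v i \<in> E \<and> norm (v i) \<le> 1)}"

definition ae_semivar :: "'x measure \<Rightarrow> ('x set \<Rightarrow> ennreal) \<Rightarrow> ('x \<Rightarrow> bool) \<Rightarrow> bool" where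
  "ae_semivar X \<phi> P \<longleftrightarrow> (\<exists>N\<in>sets X. \<phi> N = 0 \<and> (\<forall>x\<in>space X - N. P x))"

text \<open>The measure \<open>M(A)[B] = \<mu>(A) \<circ> B\<close>, defined on all real-linear \<open>B\<close>.\<close>

definition comp_measure ::
  "('x set \<Rightarrow> 'v::banach \<Rightarrow>\<^sub>L 'w::banach) \<Rightarrow> 'x set \<Rightarrow> ('u::banach \<Rightarrow>\<^sub>L 'v) \<Rightarrow>\<^sub>L ('u \<Rightarrow>\<^sub>L 'w)" where
  "comp_measure \<mu> A = Blinfun (\<lambda>B. \<mu> A o\<^sub>L B)"

lemma comp_measure_apply [simp]: "blinfun_apply (comp_measure \<mu> A) B = \<mu> A o\<^sub>L B"
  unfolding comp_measure_def
  by (simp add: bounded_linear_Blinfun_apply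
      bounded_bilinear.bounded_linear_right[OF bounded_bilinear_blinfun_compose])


section \<open>Simple and strongly measurable functions\<close>

definition simple_fun :: "'x measure \<Rightarrow> 'e set \<Rightarrow> ('x \<Rightarrow> 'e) set" where
  "simple_fun X E = {s. simple_function X s \<and> s \<in> space X \<rightarrow> E}"

definition SM :: "'x measure \<Rightarrow> ('x set \<Rightarrow> ennreal) \<Rightarrow> 'e::banach set \<Rightarrow> ('x \<Rightarrow> 'e) set" where
  "SM X \<phi> E = {f. f \<in> space X \<rightarrow> E \<and>
     (\<exists>s. (\<forall>n::nat. s n \<in> simple_fun X E) \<and> ae_semivar X \<phi> (\<lambda>x. (\<lambda>n. s n x) \<longlonglongrightarrow> f x))}"

text \<open>For \<open>[0,\<infinity>]\<close>-valued functions the limits of the real-valued simple functions are taken in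
  the extended reals.\<close>

definition SM_ennreal :: "'x measure \<Rightarrow> ('x set \<Rightarrow> ennreal) \<Rightarrow> ('x \<Rightarrow> ennreal) set" where
  "SM_ennreal X \<phi> = {f.
     \<exists>s. (\<forall>n::nat. s n \<in> simple_fun X (UNIV :: real set)) \<and>
         ae_semivar X \<phi> (\<lambda>x. (\<lambda>n. ereal (s n x)) \<longlonglongrightarrow> enn2ereal (f x))}"


section \<open>The Dobrakov integral\<close>

definition simple_int ::
  "'x measure \<Rightarrow> ('x set \<Rightarrow> 'e::banach \<Rightarrow>\<^sub>L 'g::banach) \<Rightarrow> 'x set \<Rightarrow> ('x \<Rightarrow> 'e) \<Rightarrow> 'g" where
  "simple_int X m A s =
     (\<Sum>v\<in>s ` space X. blinfun_apply (m (A \<inter> (s -` {v} \<inter> space X))) v)"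

definition dobrakov_seq ::
  "'x measure \<Rightarrow> 'e::banach set \<Rightarrow> ('x set \<Rightarrow> 'e \<Rightarrow>\<^sub>L 'g::banach) \<Rightarrow> ('x \<Rightarrow> 'e) \<Rightarrow>
   (nat \<Rightarrow> 'x \<Rightarrow> 'e) \<Rightarrow> bool" where
  "dobrakov_seq X E m f s \<longleftrightarrow>
     (\<forall>n. s n \<in> simple_fun X E) \<and>
     ae_semivar X (semivariation X E m) (\<lambda>x. (\<lambda>n. s n x) \<longlonglongrightarrow> f x) \<and>
     (\<forall>A\<in>sets X. convergent (\<lambda>n. simple_int X m A (s n)))"

definition dobrakov_integrable ::
  "'x measure \<Rightarrow> 'e::banach set \<Rightarrow> ('x set \<Rightarrow> 'e \<Rightarrow>\<^sub>L 'g::banach) \<Rightarrow> ('x \<Rightarrow> 'e) \<Rightarrow> bool" where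
  "dobrakov_integrable X E m f \<longleftrightarrow>
     f \<in> space X \<rightarrow> E \<and> (\<exists>s. dobrakov_seq X E m f s)"

definition dobrakov_integral ::
  "'x measure \<Rightarrow> 'e::banach set \<Rightarrow> ('x set \<Rightarrow> 'e \<Rightarrow>\<^sub>L 'g::banach) \<Rightarrow> 'x set \<Rightarrow> ('x \<Rightarrow> 'e) \<Rightarrow> 'g" where
  "dobrakov_integral X E m A f =
     (THE I. \<exists>s. dobrakov_seq X E m f s \<and> (\<lambda>n. simple_int X m A (s n)) \<longlonglongrightarrow> I)"


section \<open>The \<open>p\<close>-semivariation and the spaces \<open>\<L>\<^sub>p\<close>\<close>

definition ennreal_powr :: "ennreal \<Rightarrow> real \<Rightarrow> ennreal" where
  "ennreal_powr a p = (if a = \<infinity> then \<infinity> else ennreal (enn2real a powr p))"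

definition p_semivar_ennreal ::
  "'x measure \<Rightarrow> 'e::banach set \<Rightarrow> ('x set \<Rightarrow> 'e \<Rightarrow>\<^sub>L 'g::banach) \<Rightarrow> real \<Rightarrow>
   ('x \<Rightarrow> ennreal) \<Rightarrow> 'x set \<Rightarrow> ennreal" where
  "p_semivar_ennreal X E m p f A =
     Sup {ennreal (norm (simple_int X m A s) powr (1 / p)) | s.
        s \<in> simple_fun X E \<and> (\<forall>x\<in>space X. ennreal (norm (s x)) \<le> ennreal_powr (f x) p)}"

definition p_semivar ::
  "'x measure \<Rightarrow> 'e::banach set \<Rightarrow> ('x set \<Rightarrow> 'e \<Rightarrow>\<^sub>L 'g::banach) \<Rightarrow> real \<Rightarrow>
   ('x \<Rightarrow> 'e) \<Rightarrow> 'x set \<Rightarrow> ennreal" where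
  "p_semivar X E m p f A = p_semivar_ennreal X E m p (\<lambda>x. ennreal (norm (f x))) A"

definition Lp_space ::
  "'x measure \<Rightarrow> 'e::banach set \<Rightarrow> ('x set \<Rightarrow> 'e \<Rightarrow>\<^sub>L 'g::banach) \<Rightarrow> real \<Rightarrow> ('x \<Rightarrow> 'e) set" where
  "Lp_space X E m p = {f \<in> SM X (semivariation X E m) E.
     \<forall>A::nat \<Rightarrow> 'x set. range A \<subseteq> sets X \<longrightarrow> decseq A \<longrightarrow> (\<Inter>n. A n) = {} \<longrightarrow>
       (\<lambda>n. p_semivar X E m p f (A n)) \<longlonglongrightarrow> 0}"

definition Lp_space_ennreal ::
  "'x measure \<Rightarrow> 'e::banach set \<Rightarrow> ('x set \<Rightarrow> 'e \<Rightarrow>\<^sub>L 'g::banach) \<Rightarrow> real \<Rightarrow> ('x \<Rightarrow> ennreal) set"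
  where
  "Lp_space_ennreal X E m p = {f \<in> SM_ennreal X (semivariation X E m).
     \<forall>A::nat \<Rightarrow> 'x set. range A \<subseteq> sets X \<longrightarrow> decseq A \<longrightarrow> (\<Inter>n. A n) = {} \<longrightarrow>
       (\<lambda>n. p_semivar_ennreal X E m p f (A n)) \<longlonglongrightarrow> 0}"

end

theory Submission
  imports Defs
begin

text \<open>
  For a simple function \<open>s\<close>, integrating \<open>s\<close> against \<open>\<gamma>\<close> is the same as integrating \<open>g[s]\<close> against
  \<open>\<mu>\<close>. Indeed, if simple functions \<open>G n\<close> converge to \<open>g\<close> and determine its integral, then the
  simple functions \<open>G n [s]\<close> converge to \<open>g[s]\<close>, and their integrals are finite sums of terms
  \<open>(\<integral>\<^bsub>C\<^esub> G n dM) v\<close>, which converge to \<open>\<gamma>(C) v\<close> (\<open>simple_int_density_tendsto\<close>). For \<open>g[s]\<close> to be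
  a \<open>\<mu>\<close>-almost everywhere limit, an \<open>M\<close>-null set has to be \<open>\<mu>\<close>-null; unless the domain of the
  operators \<open>g(x)\<close> is zero, this follows by testing \<open>M\<close> on rank-one operators, which the Hahn--Banach theorem provides (\<open>lin_ops_rank_one\<close>).
  Part (a) is then a rewriting of the definition. Part (b) follows from it and from the
  domination of an integral by the semivariation of the norm of the integrand
  (\<open>norm_dobrakov_integral_le\<close>).

  For part (c), choose simple functions \<open>s n\<close> converging to \<open>f\<close> and \<open>h n\<close> converging to \<open>g[f]\<close>, both
  below their limits in norm. All the functions \<open>h n\<close> and \<open>g[s n]\<close> converge to \<open>g[f]\<close> almost everywhere
  and are dominated by \<open>|g||f|\<close>, so that their \<open>\<mu>\<close>-integrals have a common limit on every measurable set
  (\<open>dobrakov_integral_dominated_Cauchy\<close>). Since the \<open>\<mu>\<close>-integral of \<open>g[s n]\<close> is the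
  \<open>\<gamma>\<close>-integral of \<open>s n\<close>, this limit is both \<open>\<integral>f d\<gamma>\<close> and \<open>\<integral>g[f] d\<mu>\<close>.

  Underneath lies the independence of the integral from the approximating sequence
  (\<open>simple_int_tendsto_zero\<close>), which rests on Nikodym's convergence theorem. It is
  needed for \<open>\<gamma>\<close> as well, whose semivariation may be infinite on the whole space but is
  \<open>\<sigma>\<close>-finite.
\<close>

section \<open>Countably additive set functions and the Nikodym convergence theorem\<close>

lemma CA_empty:
  assumes "m \<in> CA X Y"
  shows "m {} = 0"
proof -
  have "(\<lambda>n::nat. m {}) sums m (\<Union>n::nat. {})"
    using assms unfolding CA_def
    by (elim CollectE conjE allE[of _ "\<lambda>_. {}"]) (simp add: disjoint_family_on_def)
  then have "(\<lambda>n::nat. m {}) \<longlonglongrightarrow> 0"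
    by (intro summable_LIMSEQ_zero) (auto simp: sums_iff)
  then show ?thesis by (simp add: LIMSEQ_const_iff)
qed

lemma CA_sums:
  assumes "m \<in> CA X Y" "range A \<subseteq> sets X" "disjoint_family A"
  shows "(\<lambda>n::nat. m (A n)) sums m (\<Union>n. A n)"
  using assms unfolding CA_def by blast

lemma CA_union:
  assumes m: "m \<in> CA X Y" and AB: "A \<in> sets X" "B \<in> sets X" "A \<inter> B = {}"
  shows "m (A \<union> B) = m A + m B"
proof -
  let ?C = "\<lambda>n::nat. if n = 0 then A else if n = 1 then B else {}"
  have "(\<lambda>n. m (?C n)) sums m (\<Union>n. ?C n)"
    using AB by (intro CA_sums[OF m]) (auto simp: disjoint_family_on_def)
  moreover have "(\<Union>n. ?C n) = A \<union> B"
    by (auto split: if_splits)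
  moreover have "(\<lambda>n. m (?C n)) sums (\<Sum>n\<in>{0,1}. m (?C n))"
    by (rule sums_finite) (auto simp: CA_empty[OF m])
  ultimately show ?thesis by (simp add: sums_iff)
qed

lemma CA_diff_set:
  assumes m: "m \<in> CA X Y" and AB: "A \<in> sets X" "B \<in> sets X" "B \<subseteq> A"
  shows "m (A - B) = m A - m B"
proof -
  have "m ((A - B) \<union> B) = m (A - B) + m B"
    using AB by (intro CA_union[OF m]) auto
  moreover have "(A - B) \<union> B = A" using AB by auto
  ultimately show ?thesis by simp
qed

lemma CA_UN_finite:
  assumes m: "m \<in> CA X Y" and "finite I" "\<And>i. i \<in> I \<Longrightarrow> A i \<in> sets X" "disjoint_family_on A I"
  shows "m (\<Union>i\<in>I. A i) = (\<Sum>i\<in>I. m (A i))"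
  using assms(2-)
proof (induction I)
  case empty
  then show ?case by (simp add: CA_empty[OF m])
next
  case (insert i I)
  have "m (A i \<union> (\<Union>j\<in>I. A j)) = m (A i) + m (\<Union>j\<in>I. A j)"
    using insert by (intro CA_union[OF m]) (auto simp: disjoint_family_on_def)
  also have "m (\<Union>j\<in>I. A j) = (\<Sum>j\<in>I. m (A j))"
    using insert by (auto simp: disjoint_family_on_def)
  finally show ?case using insert by simp
qed

lemma CA_decseq:
  assumes m: "m \<in> CA X Y" and A: "range A \<subseteq> sets X" "decseq A" "(\<Inter>n. A n) = {}"
  shows "(\<lambda>n. m (A n)) \<longlonglongrightarrow> 0"
proof -
  define D where "D n = A n - A (Suc n)" for n
  have sub: "A (Suc n) \<subseteq> A n" for n using A(2) by (simp add: decseq_Suc_iff)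
  have disj: "disjoint_family D"
    unfolding disjoint_family_on_def
  proof (intro ballI impI)
    fix i j :: nat
    assume "i \<noteq> j"
    then consider "Suc i \<le> j" | "Suc j \<le> i" by linarith
    then show "D i \<inter> D j = {}"
    proof cases
      case 1
      then have "A j \<subseteq> A (Suc i)" using A(2) by (simp add: decseqD)
      then show ?thesis by (auto simp: D_def)
    next
      case 2
      then have "A i \<subseteq> A (Suc j)" using A(2) by (simp add: decseqD)
      then show ?thesis by (auto simp: D_def)
    qed
  qed
  have UN: "(\<Union>n. D n) = A 0"
  proof
    show "(\<Union>n. D n) \<subseteq> A 0" using A(2) by (auto simp: D_def decseq_def)
    show "A 0 \<subseteq> (\<Union>n. D n)"
    proof
      fix x assume x: "x \<in> A 0"
      show "x \<in> (\<Union>n. D n)"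
      proof (rule ccontr)
        assume neg: "x \<notin> (\<Union>n. D n)"
        have "x \<in> A n" for n
          by (induction n) (use x neg in \<open>auto simp: D_def\<close>)
        then show False using A(3) by blast
      qed
    qed
  qed
  have "(\<lambda>n. m (D n)) sums m (A 0)"
    using CA_sums[OF m _ disj] A(1) unfolding UN by (auto simp: D_def image_subset_iff)
  moreover have "(\<Sum>i<n. m (D i)) = m (A 0) - m (A n)" for n
  proof (induction n)
    case (Suc n)
    have "m (D n) = m (A n) - m (A (Suc n))"
      unfolding D_def using A(1) sub by (intro CA_diff_set[OF m]) auto
    with Suc show ?case by simp
  qed simp
  ultimately have "(\<lambda>n. m (A 0) - m (A n)) \<longlonglongrightarrow> m (A 0)"
    by (simp add: sums_def)
  from tendsto_diff[OF tendsto_const[of "m (A 0)"] this] show ?thesis by simp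
qed

text \<open>
  The gliding hump. If \<open>\<nu> n (D n)\<close> stayed large along a subsequence, one could thin this
  subsequence out to \<open>r\<close> so that the off-diagonal terms \<open>\<nu> (r a) (D (r b))\<close> are negligible;
  then \<open>\<nu> (r a)\<close> would stay large on the one set \<open>\<Union>b. D (r b)\<close>.
\<close>

lemma diagonal_tendsto_zero:
  fixes \<nu> :: "nat \<Rightarrow> 'x set \<Rightarrow> 'g::banach"
  assumes ca: "\<And>n. \<nu> n \<in> CA X UNIV"
    and lim: "\<And>A. A \<in> sets X \<Longrightarrow> (\<lambda>n. \<nu> n A) \<longlonglongrightarrow> 0"
    and D: "range D \<subseteq> sets X" "disjoint_family D"
  shows "(\<lambda>n. \<nu> n (D n)) \<longlonglongrightarrow> 0"
proof (rule ccontr)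
  assume "\<not> ?thesis"
  then obtain e where e: "e > 0" and freq: "\<And>N. \<exists>n\<ge>N. e \<le> norm (\<nu> n (D n))"
    unfolding LIMSEQ_iff by (auto simp: not_less)
  have row: "(\<lambda>j. \<nu> n (D j)) \<longlonglongrightarrow> 0" for n
    using CA_sums[OF ca D, of n] by (intro summable_LIMSEQ_zero) (auto simp: sums_iff)
  have col: "(\<lambda>n. \<nu> n (D j)) \<longlonglongrightarrow> 0" for j
    using lim D by blast
  \<comment> \<open>\<open>P K K'\<close>: the index \<open>K'\<close> may follow \<open>K\<close>. All indices up to \<open>K\<close> are controlled, so only the
    last index chosen has to be remembered.\<close>
  define P where "P K K' \<longleftrightarrow> K < K' \<and> e \<le> norm (\<nu> K' (D K')) \<and>
      (\<forall>j\<le>K. norm (\<nu> K' (D j)) \<le> e / 2 ^ (j + 3)) \<and>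
      (\<forall>n\<le>K. norm (\<nu> n (D K')) \<le> e / 2 ^ (K + 4))" for K K'
  have step: "\<exists>K'. P K K'" for K
  proof -
    have small: "\<forall>\<^sub>F n in sequentially. norm (x n) \<le> d"
      if "x \<longlonglongrightarrow> 0" "d > 0" for x :: "nat \<Rightarrow> 'g" and d
    proof -
      have "\<forall>\<^sub>F n in sequentially. norm (x n) < d"
        using tendstoD[OF that] by simp
      then show ?thesis by (rule eventually_mono) simp
    qed
    have "\<forall>\<^sub>F n in sequentially. \<forall>j\<in>{..K}. norm (\<nu> n (D j)) \<le> e / 2 ^ (j + 3)"
      using e by (intro eventually_ball_finite ballI small col) auto
    moreover have "\<forall>\<^sub>F j in sequentially. \<forall>n\<in>{..K}. norm (\<nu> n (D j)) \<le> e / 2 ^ (K + 4)"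
      using e by (intro eventually_ball_finite ballI small row) auto
    moreover have "\<forall>\<^sub>F n in sequentially. K < n"
      by (rule eventually_gt_at_top)
    ultimately have "\<forall>\<^sub>F K' in sequentially. K < K' \<and>
        (\<forall>j\<le>K. norm (\<nu> K' (D j)) \<le> e / 2 ^ (j + 3)) \<and>
        (\<forall>n\<le>K. norm (\<nu> n (D K')) \<le> e / 2 ^ (K + 4))"
      by eventually_elim auto
    then obtain N where "\<And>K'. K' \<ge> N \<Longrightarrow> K < K' \<and>
        (\<forall>j\<le>K. norm (\<nu> K' (D j)) \<le> e / 2 ^ (j + 3)) \<and>
        (\<forall>n\<le>K. norm (\<nu> n (D K')) \<le> e / 2 ^ (K + 4))"
      by (auto simp: eventually_sequentially)
    with freq[of N] show ?thesis unfolding P_def by blast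
  qed
  obtain r0 where "P 0 r0" using step by blast
  obtain r where r0: "r 0 = r0" and rS: "\<And>a. P (r a) (r (Suc a))"
  proof -
    have "\<exists>r. \<forall>a. True \<and> (a = 0 \<longrightarrow> r a = r0) \<and> P (r a) (r (Suc a))"
      using dependent_nat_choice[of "\<lambda>a x. a = 0 \<longrightarrow> x = r0" "\<lambda>_. P"] step by auto
    then show ?thesis using that by blast
  qed
  have mono: "strict_mono r"
    using rS by (auto simp: strict_mono_Suc_iff P_def)
  have ge: "b \<le> r b" for b using mono by (rule strict_mono_imp_increasing)
  have diag: "e \<le> norm (\<nu> (r a) (D (r a)))" for a
    using rS \<open>P 0 r0\<close> r0 by (cases a) (auto simp: P_def)
  have off: "norm (\<nu> (r a) (D (r b))) \<le> e / 8 * (1/2) ^ b" if "a \<noteq> b" for a b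
  proof (cases "b < a")
    case True
    then obtain c where c: "a = Suc c" "b \<le> c" by (cases a) auto
    then have "r b \<le> r c" using mono by (simp add: strict_mono_less_eq)
    with rS[of c] c have "norm (\<nu> (r a) (D (r b))) \<le> e / 2 ^ (r b + 3)"
      by (auto simp: P_def)
    also have "\<dots> \<le> e / 2 ^ (b + 3)"
      using e ge[of b] by (intro divide_left_mono power_increasing) auto
    finally show ?thesis by (simp add: power_add power_divide mult.commute)
  next
    case False
    with that obtain c where c: "b = Suc c" "a \<le> c" by (cases b) auto
    then have "r a \<le> r c" using mono by (simp add: strict_mono_less_eq)
    with rS[of c] c have "norm (\<nu> (r a) (D (r b))) \<le> e / 2 ^ (r c + 4)"
      by (auto simp: P_def)
    also have "\<dots> \<le> e / 2 ^ (c + 4)"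
      using e ge[of c] by (intro divide_left_mono power_increasing) auto
    finally show ?thesis using c by (simp add: power_add power_divide mult.commute)
  qed
  define U where "U = (\<Union>b. D (r b))"
  have U: "U \<in> sets X" using D by (auto simp: U_def)
  have big: "norm (\<nu> (r a) U) \<ge> 3/4 * e" for a
  proof -
    have "disjoint_family (\<lambda>b. D (r b))"
      using D(2) strict_mono_eq[OF mono] by (auto simp: disjoint_family_on_def)
    then have s: "(\<lambda>b. \<nu> (r a) (D (r b))) sums \<nu> (r a) U"
      unfolding U_def using D(1) by (intro CA_sums[OF ca]) auto
    have "(\<lambda>b. if b = a then \<nu> (r a) (D (r b)) else 0) sums \<nu> (r a) (D (r a))"
      using sums_single[of a "\<lambda>b. \<nu> (r a) (D (r b))"] by simp
    from sums_diff[OF s this]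
    have d: "(\<lambda>b. if b = a then 0 else \<nu> (r a) (D (r b))) sums (\<nu> (r a) U - \<nu> (r a) (D (r a)))"
      by (rule back_subst[of "\<lambda>f. f sums _"]) auto
    have g: "(\<lambda>b. e / 8 * (1/2) ^ b) sums (e / 8 * 2)"
      using sums_mult[OF geometric_sums[of "1/2::real"], of "e/8"] by simp
    have "norm (\<Sum>b. if b = a then 0 else \<nu> (r a) (D (r b))) \<le> (\<Sum>b. e / 8 * (1/2) ^ b)"
    proof (rule norm_suminf_le)
      show "norm (if b = a then 0 else \<nu> (r a) (D (r b))) \<le> e / 8 * (1/2) ^ b" for b
        using off[of a b] e by (cases "a = b") auto
      show "summable (\<lambda>b. e / 8 * (1/2) ^ b)"
        using g by (rule sums_summable)
    qed
    then have "norm (\<nu> (r a) U - \<nu> (r a) (D (r a))) \<le> e / 4"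
      using d g by (simp add: sums_iff)
    then show ?thesis
      using diag[of a] norm_triangle_ineq3[of "\<nu> (r a) U" "\<nu> (r a) (D (r a))"] by linarith
  qed
  have "(\<lambda>a. \<nu> (r a) U) \<longlonglongrightarrow> 0"
    using LIMSEQ_subseq_LIMSEQ[OF lim[OF U] mono] by (simp add: o_def)
  then have "\<forall>\<^sub>F a in sequentially. norm (\<nu> (r a) U) < 3/4 * e"
    using e tendstoD[of "\<lambda>a. \<nu> (r a) U" 0 sequentially "3/4 * e"] by simp
  then show False using big by (auto simp: eventually_sequentially not_less[symmetric])
qed

lemma CA_diff:
  assumes "\<nu> \<in> CA X UNIV" "\<nu>' \<in> CA X UNIV"
  shows "(\<lambda>A. \<nu> A - \<nu>' A) \<in> CA X UNIV"
  using assms unfolding CA_def by (auto intro: sums_diff)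

text \<open>Nikodym's theorem: a setwise convergent sequence of measures is uniformly countably additive.\<close>

lemma Nikodym_convergence:
  fixes \<nu> :: "nat \<Rightarrow> 'x set \<Rightarrow> 'g::banach"
  assumes ca: "\<And>n. \<nu> n \<in> CA X UNIV"
    and conv: "\<And>A. A \<in> sets X \<Longrightarrow> convergent (\<lambda>n. \<nu> n A)"
    and A: "range A \<subseteq> sets X" "decseq A" "(\<Inter>n. A n) = {}"
    and e: "e > 0"
  shows "\<exists>K. \<forall>k\<ge>K. \<forall>n. norm (\<nu> n (A k)) \<le> e"
proof (rule ccontr)
  assume neg: "\<not> ?thesis"
  \<comment> \<open>Pairs \<open>(n, k)\<close> such that \<open>\<nu> n (A k)\<close> is large, while the previous measure is already small
    on \<open>A l\<close> for all \<open>l \<ge> k\<close>; differences of consecutive measures then contradict the gliding hump.\<close>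
  define Q where "Q q q' \<longleftrightarrow> fst q < (fst q'::nat) \<and> snd q < (snd q'::nat) \<and>
      e < norm (\<nu> (fst q') (A (snd q'))) \<and> (\<forall>l\<ge>snd q'. norm (\<nu> (fst q) (A l)) < e / 4)" for q q'
  have step: "\<exists>q'. Q q q'" for q
  proof -
    have "\<forall>\<^sub>F l in sequentially. \<forall>i\<in>{..fst q}. norm (\<nu> i (A l)) < e / 4"
      using e tendstoD[OF CA_decseq[OF ca A], of "e / 4"]
      by (intro eventually_ball_finite ballI) auto
    then obtain L where L: "\<And>l i. l \<ge> L \<Longrightarrow> i \<le> fst q \<Longrightarrow> norm (\<nu> i (A l)) < e / 4"
      by (auto simp: eventually_sequentially)
    obtain k n where kn: "k \<ge> max (Suc (snd q)) L" "e < norm (\<nu> n (A k))"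
      using neg by (meson not_less)
    have "fst q < n"
    proof (rule ccontr)
      assume "\<not> fst q < n"
      then have "norm (\<nu> n (A k)) < e / 4" using kn by (intro L) auto
      with kn e show False by simp
    qed
    with kn L show ?thesis by (intro exI[of _ "(n, k)"]) (auto simp: Q_def)
  qed
  then obtain r where r: "\<And>i. Q (r i) (r (Suc i))"
    using dependent_nat_choice[of "\<lambda>_ _. True" "\<lambda>_. Q"] by auto
  define n where "n i = fst (r i)" for i
  define k where "k i = snd (r i)" for i
  have n: "strict_mono n" and k: "strict_mono k"
    using r by (auto simp: strict_mono_Suc_iff Q_def n_def k_def)
  have large: "e < norm (\<nu> (n (Suc i)) (A (k (Suc i))))" for i
    using r[of i] by (simp add: Q_def n_def k_def)
  have small: "norm (\<nu> (n i) (A l)) < e / 4" if "l \<ge> k (Suc i)" for i l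
    using r[of i] that by (simp add: Q_def n_def k_def)
  define D where "D i = A (k (Suc i)) - A (k (Suc (Suc i)))" for i
  define y where "y i B = \<nu> (n (Suc i)) B - \<nu> (n i) B" for i B
  have As: "A i \<in> sets X" for i using A by auto
  have sub: "A j \<subseteq> A i" if "i \<le> j" for i j using A(2) that by (simp add: decseqD)
  have kle: "k i \<le> k j" if "i \<le> j" for i j using k that by (simp add: strict_mono_less_eq)
  have "(\<lambda>i. y i (D i)) \<longlonglongrightarrow> 0"
  proof (rule diagonal_tendsto_zero)
    show "y i \<in> CA X UNIV" for i unfolding y_def by (intro CA_diff ca)
    show "(\<lambda>i. y i B) \<longlonglongrightarrow> 0" if "B \<in> sets X" for B
    proof -
      obtain L where L: "(\<lambda>i. \<nu> i B) \<longlonglongrightarrow> L"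
        using conv[OF \<open>B \<in> sets X\<close>] by (auto simp: convergent_def)
      have 1: "(\<lambda>i. \<nu> (n i) B) \<longlonglongrightarrow> L"
        using LIMSEQ_subseq_LIMSEQ[OF L n] by (simp add: o_def)
      from tendsto_diff[OF LIMSEQ_Suc[OF 1] 1] show ?thesis by (simp add: y_def)
    qed
    show "range D \<subseteq> sets X" using As by (auto simp: D_def)
    show "disjoint_family D"
      unfolding disjoint_family_on_def
    proof (intro ballI impI)
      fix i j :: nat
      assume "i \<noteq> j"
      then consider "Suc i \<le> j" | "Suc j \<le> i" by linarith
      then show "D i \<inter> D j = {}"
      proof cases
        case 1
        then have "A (k (Suc j)) \<subseteq> A (k (Suc (Suc i)))" by (intro sub kle) auto
        then show ?thesis by (auto simp: D_def)
      next
        case 2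
        then have "A (k (Suc i)) \<subseteq> A (k (Suc (Suc j)))" by (intro sub kle) auto
        then show ?thesis by (auto simp: D_def)
      qed
    qed
  qed
  moreover have "e / 4 \<le> norm (y i (D i))" for i
  proof -
    have D: "\<nu> j (D i) = \<nu> j (A (k (Suc i))) - \<nu> j (A (k (Suc (Suc i))))" for j
      unfolding D_def by (intro CA_diff_set[OF ca] As sub kle) auto
    have "norm (y i (D i)) \<ge> norm (\<nu> (n (Suc i)) (D i)) - norm (\<nu> (n i) (D i))"
      unfolding y_def by (rule norm_triangle_ineq2)
    moreover have "norm (\<nu> (n (Suc i)) (D i))
        \<ge> norm (\<nu> (n (Suc i)) (A (k (Suc i)))) - norm (\<nu> (n (Suc i)) (A (k (Suc (Suc i)))))"
      unfolding D by (rule norm_triangle_ineq2)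
    moreover have "norm (\<nu> (n i) (D i))
        \<le> norm (\<nu> (n i) (A (k (Suc i)))) + norm (\<nu> (n i) (A (k (Suc (Suc i)))))"
      unfolding D by (rule norm_triangle_ineq4)
    moreover have "norm (\<nu> (n (Suc i)) (A (k (Suc (Suc i))))) < e / 4"
      "norm (\<nu> (n i) (A (k (Suc i)))) < e / 4" "norm (\<nu> (n i) (A (k (Suc (Suc i))))) < e / 4"
      by (intro small kle; simp)+
    ultimately show ?thesis using large[of i] by linarith
  qed
  ultimately show False
    using e tendstoD[of "\<lambda>i. y i (D i)" 0 sequentially "e/4"]
    by (auto simp: eventually_sequentially not_less[symmetric])
qed

section \<open>The integral of simple functions\<close>

text \<open>
  An operator-valued measure \<open>m\<close> whose integrands take values in a linear subspace \<open>E\<close> of the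
  domain of the operators.
\<close>

locale operator_measure =
  fixes X :: "'x measure" and E :: "'e::banach set" and m :: "'x set \<Rightarrow> 'e \<Rightarrow>\<^sub>L 'g::banach"
  assumes subspace_E: "subspace E" and ca: "m \<in> CA X UNIV"

lemma simple_fun_simple_function: "s \<in> simple_fun X E \<Longrightarrow> simple_function X s"
  by (simp add: simple_fun_def)

lemma simple_fun_mem: "s \<in> simple_fun X E \<Longrightarrow> x \<in> space X \<Longrightarrow> s x \<in> E"
  by (auto simp: simple_fun_def)

lemma simple_fun_diff:
  assumes "subspace E" "s \<in> simple_fun X E" "t \<in> simple_fun X E"
  shows "(\<lambda>x. s x - t x) \<in> simple_fun X E"
  using assms by (auto simp: simple_fun_def Pi_iff subspace_diff intro: simple_function_compose2)

lemma semivariation_mono: "A \<subseteq> B \<Longrightarrow> semivariation X E m A \<le> semivariation X E m B"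
  unfolding semivariation_def by (intro Sup_subset_mono) blast

context operator_measure
begin

lemma semivariation_0D:
  assumes N: "semivariation X E m N = 0" and A: "A \<in> sets X" "A \<subseteq> N" and v: "v \<in> E"
  shows "m A v = 0"
proof (cases "v = 0")
  case False
  let ?w = "(1 / norm v) *\<^sub>R v"
  have "ennreal (norm (\<Sum>i<1::nat. blinfun_apply (m ((\<lambda>_. A) i)) ((\<lambda>_. ?w) i)))
      \<le> semivariation X E m N"
    unfolding semivariation_def
    using A v False subspace_E
    by (intro Sup_upper CollectI exI[of _ 1] exI[of _ "\<lambda>_. A"] exI[of _ "\<lambda>_. ?w"] conjI refl)
      (auto simp: disjoint_family_on_def subspace_scale)
  with N have "m A ?w = 0" by (simp add: ennreal_eq_0_iff)
  with False show ?thesis by (simp add: blinfun.scaleR_right)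
qed simp

lemma semivariation_eq_0I:
  assumes "\<And>A v. A \<in> sets X \<Longrightarrow> A \<subseteq> N \<Longrightarrow> v \<in> E \<Longrightarrow> m A v = 0"
  shows "semivariation X E m N = 0"
proof -
  have "semivariation X E m N \<le> 0"
    unfolding semivariation_def by (intro Sup_least) (auto simp: assms)
  then show ?thesis by simp
qed

lemma semivariation_Un_null:
  assumes N: "N1 \<in> sets X" "N2 \<in> sets X"
    "semivariation X E m N1 = 0" "semivariation X E m N2 = 0"
  shows "semivariation X E m (N1 \<union> N2) = 0"
proof (rule semivariation_eq_0I)
  fix A v
  assume A: "A \<in> sets X" "A \<subseteq> N1 \<union> N2" and v: "v \<in> E"
  have "m ((A \<inter> N1) \<union> (A - N1)) = m (A \<inter> N1) + m (A - N1)"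
    using A N by (intro CA_union[OF ca]) auto
  moreover have "(A \<inter> N1) \<union> (A - N1) = A" by auto
  moreover have "m (A \<inter> N1) v = 0" using A N v by (intro semivariation_0D[of N1]) auto
  moreover have "m (A - N1) v = 0" using A N v by (intro semivariation_0D[of N2]) auto
  ultimately show "m A v = 0" by (simp add: blinfun.add_left)
qed

text \<open>The integral may be computed on any finite measurable partition on which \<open>s\<close> is constant.\<close>

lemma simple_int_refine:
  assumes q: "simple_function X q" and s: "\<And>x. x \<in> space X \<Longrightarrow> s x = \<phi> (q x)"
    and A: "A \<in> sets X"
  shows "simple_int X m A s =
    (\<Sum>c\<in>q ` space X. blinfun_apply (m (A \<inter> (q -` {c} \<inter> space X))) (\<phi> c))"
proof -
  let ?t = "\<lambda>c. blinfun_apply (m (A \<inter> (q -` {c} \<inter> space X))) (\<phi> c)"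
  have fin: "finite (q ` space X)" using q by (rule simple_functionD)
  have im: "\<phi> ` (q ` space X) = s ` space X" using s by (auto simp: image_iff)
  have "sum ?t (q ` space X) = (\<Sum>v\<in>s ` space X. sum ?t {c \<in> q ` space X. \<phi> c = v})"
    using sum.image_gen[OF fin, of ?t \<phi>] by (simp add: im)
  also have "\<dots> = simple_int X m A s"
    unfolding simple_int_def
  proof (rule sum.cong[OF refl])
    fix v assume "v \<in> s ` space X"
    let ?I = "{c \<in> q ` space X. \<phi> c = v}"
    have "A \<inter> (s -` {v} \<inter> space X) = (\<Union>c\<in>?I. A \<inter> (q -` {c} \<inter> space X))"
      using s by auto
    also have "m \<dots> = (\<Sum>c\<in>?I. m (A \<inter> (q -` {c} \<inter> space X)))"
      using fin A simple_functionD(2)[OF q]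
      by (intro CA_UN_finite[OF ca]) (auto simp: disjoint_family_on_def)
    finally show "sum ?t ?I = blinfun_apply (m (A \<inter> (s -` {v} \<inter> space X))) v"
      by (simp add: blinfun.sum_left)
  qed
  finally show ?thesis ..
qed

lemma simple_int_diff:
  assumes s: "simple_function X s" and t: "simple_function X t" and A: "A \<in> sets X"
  shows "simple_int X m A (\<lambda>x. s x - t x) = simple_int X m A s - simple_int X m A t"
proof -
  have q: "simple_function X (\<lambda>x. (s x, t x))" using s t by simp
  show ?thesis
    by (simp add: simple_int_refine[OF q _ A, of _ "\<lambda>(a, b). a - b"]
        simple_int_refine[OF q _ A, of s fst] simple_int_refine[OF q _ A, of t snd]
        blinfun.diff_right sum_subtractf[symmetric] case_prod_beta)
qed

lemma simple_int_CA:
  assumes s: "simple_function X s"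
  shows "(\<lambda>A. simple_int X m A s) \<in> CA X UNIV"
  unfolding CA_def
proof (intro CollectI conjI ballI allI impI UNIV_I)
  fix A :: "nat \<Rightarrow> 'x set"
  assume A: "range A \<subseteq> sets X" "disjoint_family A"
  show "(\<lambda>n. simple_int X m (A n) s) sums simple_int X m (\<Union>n. A n) s"
    unfolding simple_int_def
  proof (rule sums_sum)
    fix v
    let ?S = "s -` {v} \<inter> space X"
    have "(\<lambda>n. m (A n \<inter> ?S)) sums m (\<Union>n. A n \<inter> ?S)"
    proof (rule CA_sums[OF ca])
      show "range (\<lambda>n. A n \<inter> ?S) \<subseteq> sets X"
        using A(1) simple_functionD(2)[OF s] by blast
      show "disjoint_family (\<lambda>n. A n \<inter> ?S)"
        using A(2) by (rule disjoint_family_on_bisimulation) auto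
    qed
    from bounded_linear.sums[OF blinfun.bounded_linear_left this, of v]
    show "(\<lambda>n. blinfun_apply (m (A n \<inter> ?S)) v) sums blinfun_apply (m ((\<Union>n. A n) \<inter> ?S)) v"
      by simp
  qed
qed

lemma simple_int_eq_0:
  assumes "\<And>x. x \<in> A \<Longrightarrow> s x = 0"
  shows "simple_int X m A s = 0"
  unfolding simple_int_def
proof (rule sum.neutral, rule ballI)
  fix v assume "v \<in> s ` space X"
  show "blinfun_apply (m (A \<inter> (s -` {v} \<inter> space X))) v = 0"
  proof (cases "v = 0")
    case False
    then have "A \<inter> (s -` {v} \<inter> space X) = {}" using assms by auto
    then show ?thesis by (simp add: CA_empty[OF ca])
  qed simp
qed

lemma simple_int_cong_on:
  assumes "simple_function X s" "simple_function X t" "A \<in> sets X" "\<And>x. x \<in> A \<Longrightarrow> s x = t x"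
  shows "simple_int X m A s = simple_int X m A t"
proof -
  have "simple_int X m A (\<lambda>x. s x - t x) = 0" using assms(4) by (intro simple_int_eq_0) simp
  then show ?thesis using simple_int_diff[OF assms(1-3)] by simp
qed

lemma simple_int_const:
  assumes A: "A \<in> sets X"
  shows "simple_int X m A (\<lambda>_. v) = m A v"
proof (cases "space X = {}")
  case True
  with sets.sets_into_space[OF A] show ?thesis by (simp add: simple_int_def CA_empty[OF ca])
next
  case False
  then have "(\<lambda>_. v) ` space X = {v}" by auto
  with sets.sets_into_space[OF A] show ?thesis by (simp add: simple_int_def Int_absorb2)
qed

lemma simple_int_null:
  assumes s: "s \<in> simple_fun X E" and A: "A \<in> sets X" "A \<subseteq> N"
    and N: "semivariation X E m N = 0"
  shows "simple_int X m A s = 0"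
  unfolding simple_int_def
proof (intro sum.neutral ballI semivariation_0D[OF N])
  fix v assume v: "v \<in> s ` space X"
  then show "v \<in> E" using simple_fun_mem[OF s] by blast
  show "A \<inter> (s -` {v} \<inter> space X) \<in> sets X"
    using A simple_functionD(2)[OF simple_fun_simple_function[OF s]] by blast
  show "A \<inter> (s -` {v} \<inter> space X) \<subseteq> N" using A by blast
qed

lemma simple_int_bound_ennreal:
  assumes s: "s \<in> simple_fun X E" and A: "A \<in> sets X" "A \<subseteq> Z"
    and C: "C > 0" "\<And>x. x \<in> A \<Longrightarrow> norm (s x) \<le> C"
  shows "ennreal (norm (simple_int X m A s)) \<le> ennreal C * semivariation X E m Z"
proof -
  have sf: "simple_function X s" using s by (rule simple_fun_simple_function)
  define V where "V = {v \<in> s ` space X. A \<inter> (s -` {v} \<inter> space X) \<noteq> {}}"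
  have fin: "finite V" using simple_functionD(1)[OF sf] by (simp add: V_def)
  obtain h where h: "bij_betw h {..<card V} V"
    using ex_bij_betw_nat_finite[OF fin] by (auto simp: atLeast0LessThan)
  define B where "B i = A \<inter> (s -` {h i} \<inter> space X)" for i
  define w where "w i = (1 / C) *\<^sub>R h i" for i
  have hV: "h i \<in> V" if "i < card V" for i using h that by (auto simp: bij_betw_def)
  have "simple_int X m A s = (\<Sum>v\<in>V. blinfun_apply (m (A \<inter> (s -` {v} \<inter> space X))) v)"
    unfolding simple_int_def using simple_functionD(1)[OF sf]
    by (intro sum.mono_neutral_right) (auto simp: V_def CA_empty[OF ca])
  also have "\<dots> = (\<Sum>i<card V. blinfun_apply (m (B i)) (h i))"
    unfolding B_def by (rule sum.reindex_bij_betw[OF h, symmetric])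
  also have "\<dots> = C *\<^sub>R (\<Sum>i<card V. blinfun_apply (m (B i)) (w i))"
    using C by (simp add: w_def scaleR_sum_right blinfun.scaleR_right)
  finally have "norm (simple_int X m A s) = C * norm (\<Sum>i<card V. blinfun_apply (m (B i)) (w i))"
    using C by simp
  moreover have "ennreal (norm (\<Sum>i<card V. blinfun_apply (m (B i)) (w i))) \<le> semivariation X E m Z"
    unfolding semivariation_def
  proof (intro Sup_upper CollectI exI[of _ "card V"] exI[of _ B] exI[of _ w] conjI refl allI impI)
    fix i assume i: "i < card V"
    show "B i \<in> sets X" "B i \<subseteq> Z" using A simple_functionD(2)[OF sf] by (auto simp: B_def)
    from hV[OF i] obtain x where x: "x \<in> A" "x \<in> space X" "s x = h i" by (auto simp: V_def)
    with s have "h i \<in> E" by (metis simple_fun_mem)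
    then show "w i \<in> E" using subspace_E by (simp add: w_def subspace_scale)
    show "norm (w i) \<le> 1" using C(1) x C(2)[OF x(1)] by (simp add: w_def)
  next
    show "disjoint_family_on B {..<card V}"
      using bij_betw_imp_inj_on[OF h] by (auto simp: disjoint_family_on_def B_def inj_on_def)
  qed
  ultimately show ?thesis
    using C by (simp add: ennreal_mult mult_left_mono)
qed

lemma simple_int_bound:
  assumes "s \<in> simple_fun X E" "A \<in> sets X" "A \<subseteq> Z" "C > 0" "\<And>x. x \<in> A \<Longrightarrow> norm (s x) \<le> C"
    and Z: "semivariation X E m Z < \<infinity>"
  shows "norm (simple_int X m A s) \<le> C * enn2real (semivariation X E m Z)"
proof -
  have "ennreal (norm (simple_int X m A s)) \<le> ennreal C * semivariation X E m Z"
    using assms by (intro simple_int_bound_ennreal)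
  also have "\<dots> = ennreal (C * enn2real (semivariation X E m Z))"
    using Z \<open>C > 0\<close> by (simp add: ennreal_mult less_top)
  finally show ?thesis using \<open>C > 0\<close> by (simp add: ennreal_le_iff)
qed

text \<open>
  The values of the supremum that defines the semivariation are norms of integrals of simple
  functions of norm at most 1.
\<close>

lemma semivariation_leI:
  assumes Z: "Z \<in> sets X"
    and le: "\<And>A s. A \<in> sets X \<Longrightarrow> A \<subseteq> Z \<Longrightarrow> s \<in> simple_fun X E \<Longrightarrow> (\<And>x. norm (s x) \<le> 1) \<Longrightarrow>
      ennreal (norm (simple_int X m A s)) \<le> K"
  shows "semivariation X E m Z \<le> K"
  unfolding semivariation_def
proof (intro Sup_least, elim CollectE exE conjE, goal_cases)
  case (1 y n B v)
  define s where "s x = (\<Sum>i<n. indicator (B i) x *\<^sub>R v i)" for x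
  define A where "A = (\<Union>i<n. B i)"
  have B: "B i \<in> sets X" "B i \<subseteq> Z" "v i \<in> E" "norm (v i) \<le> 1" if "i < n" for i
    using 1 that by auto
  have sB: "s x = v i" if "i < n" "x \<in> B i" for i x
  proof -
    have "x \<notin> B j" if "j < n" "j \<noteq> i" for j
      using \<open>disjoint_family_on B {..<n}\<close> \<open>i < n\<close> \<open>x \<in> B i\<close> that
      by (auto simp: disjoint_family_on_def)
    then have "s x = (\<Sum>j<n. if j = i then v i else 0)"
      unfolding s_def using \<open>x \<in> B i\<close> by (intro sum.cong) auto
    then show ?thesis using \<open>i < n\<close> by simp
  qed
  have s0: "s x = 0" if "x \<notin> A" for x
    using that by (auto simp: s_def A_def indicator_def intro!: sum.neutral)
  have sf: "simple_function X s"
    unfolding s_def using B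
    by (intro simple_function_sum simple_function_compose1[OF simple_function_indicator]) auto
  have sE: "s \<in> simple_fun X E"
    unfolding simple_fun_def s_def
    using sf[unfolded s_def[abs_def]] subspace_E B
    by (auto intro!: subspace_sum subspace_scale)
  have s1: "norm (s x) \<le> 1" for x
    using s0[of x] sB[of _ x] B by (cases "x \<in> A") (auto simp: A_def)
  have "simple_int X m A s = (\<Sum>i<n. simple_int X m (B i) s)"
    unfolding A_def using 1 by (intro CA_UN_finite[OF simple_int_CA[OF sf]]) auto
  also have "\<dots> = (\<Sum>i<n. m (B i) (v i))"
  proof (rule sum.cong[OF refl])
    fix i assume i: "i \<in> {..<n}"
    then have "simple_int X m (B i) s = simple_int X m (B i) (\<lambda>_. v i)"
      using B sB by (intro simple_int_cong_on sf) auto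
    then show "simple_int X m (B i) s = m (B i) (v i)" using B i by (simp add: simple_int_const)
  qed
  finally have "simple_int X m A s = (\<Sum>i<n. m (B i) (v i))" .
  moreover have "ennreal (norm (simple_int X m A s)) \<le> K"
    using B s1 by (intro le sE) (auto simp: A_def)
  ultimately show ?case using 1 by simp
qed

end

section \<open>The integral of a limit of simple functions\<close>

lemma sets_Collect_all_ge:
  fixes P :: "nat \<Rightarrow> 'x \<Rightarrow> bool"
  assumes A: "A \<in> sets X" and P: "\<And>n. n \<ge> k \<Longrightarrow> {x\<in>space X. P n x} \<in> sets X"
  shows "{x\<in>A. \<forall>n\<ge>k. P n x} \<in> sets X"
proof -
  have "{x\<in>A. \<forall>n\<ge>k. P n x} = A \<inter> (\<Inter>n\<in>{k..}. {x\<in>space X. P n x})"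
    using sets.sets_into_space[OF A] by auto
  also have "\<dots> \<in> sets X"
    using A P by (intro sets.Int sets.countable_INT') auto
  finally show ?thesis .
qed

lemma sets_Collect_simple_function:
  assumes "simple_function X f"
  shows "{x\<in>space X. P (f x)} \<in> sets X"
proof -
  have "{x\<in>space X. P (f x)} = f -` Collect P \<inter> space X" by auto
  then show ?thesis using simple_functionD(2)[OF assms, of "Collect P"] by argo
qed

text \<open>
  The semivariation is finite on the members of an increasing sequence of sets that exhausts the
  space up to a null set.
\<close>

locale sigma_finite_operator_measure = operator_measure +
  assumes sigma_finite: "\<exists>Y::nat \<Rightarrow> 'a set. range Y \<subseteq> sets X \<and> incseq Y \<and>
    (\<forall>j. semivariation X E m (Y j) < \<infinity>) \<and> semivariation X E m (space X - (\<Union>j. Y j)) = 0"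

locale finite_operator_measure = operator_measure +
  assumes finite: "semivariation X E m (space X) < \<infinity>"

context operator_measure
begin

lemma simple_int_Un:
  assumes "simple_function X s" "A \<in> sets X" "B \<in> sets X" "A \<inter> B = {}"
  shows "simple_int X m (A \<union> B) s = simple_int X m A s + simple_int X m B s"
  by (rule CA_union[OF simple_int_CA[OF assms(1)] assms(2-)])

lemma simple_int_split:
  assumes "simple_function X s" "A \<in> sets X" "B \<in> sets X" "B \<subseteq> A"
  shows "simple_int X m A s = simple_int X m B s + simple_int X m (A - B) s"
  using simple_int_Un[of s B "A - B"] assms by (simp add: Un_absorb1)

lemma simple_int_uniform_tail:
  assumes u: "\<And>n::nat. simple_function X (u n)"
    and conv: "\<And>A. A \<in> sets X \<Longrightarrow> convergent (\<lambda>n. simple_int X m A (u n))"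
    and A: "A \<in> sets X" and B: "\<And>k. B k \<in> sets X" "incseq B" "A \<subseteq> (\<Union>k. B k)" and e: "e > 0"
  shows "\<exists>K. \<forall>k\<ge>K. \<forall>n. norm (simple_int X m (A - B k) (u n)) \<le> e"
proof (rule Nikodym_convergence[where A = "\<lambda>k. A - B k"])
  show "(\<lambda>A. simple_int X m A (u n)) \<in> CA X UNIV" for n by (intro simple_int_CA u)
  show "range (\<lambda>k. A - B k) \<subseteq> sets X" using A B by auto
  show "decseq (\<lambda>k. A - B k)" using B(2) by (fastforce simp: incseq_def decseq_def)
  show "(\<Inter>k. A - B k) = {}" using B(3) by auto
qed (use conv e in auto)

end

context sigma_finite_operator_measure
begin

text \<open>
  This makes the integral independent of the approximating sequence. Off a small set, uniformly
  in \<open>n\<close> by Nikodym's theorem, the semivariation is finite and \<open>u n\<close> is uniformly small for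
  large \<open>n\<close>; this replaces Egorov's theorem, so that no control measure is needed.
\<close>

lemma simple_int_tendsto_zero:
  assumes u: "\<And>n::nat. u n \<in> simple_fun X E"
    and N: "N \<in> sets X" "semivariation X E m N = 0"
    and lim: "\<And>x. x \<in> space X - N \<Longrightarrow> (\<lambda>n. u n x) \<longlonglongrightarrow> 0"
    and conv: "\<And>A. A \<in> sets X \<Longrightarrow> convergent (\<lambda>n. simple_int X m A (u n))"
    and A: "A \<in> sets X"
  shows "(\<lambda>n. simple_int X m A (u n)) \<longlonglongrightarrow> 0"
proof (rule LIMSEQ_I)
  fix e :: real assume e: "e > 0"
  have sf: "simple_function X (u n)" for n using u by (rule simple_fun_simple_function)
  obtain Y :: "nat \<Rightarrow> 'a set" where Y: "range Y \<subseteq> sets X" "incseq Y"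
    "\<And>j. semivariation X E m (Y j) < \<infinity>" "semivariation X E m (space X - (\<Union>j. Y j)) = 0"
    using sigma_finite by auto
  define N' where "N' = N \<union> (space X - (\<Union>j. Y j))"
  have N': "N' \<in> sets X" "semivariation X E m N' = 0"
    unfolding N'_def using N Y by (auto intro!: semivariation_Un_null)
  define A' where "A' = A - N'"
  have A': "A' \<in> sets X" "A' \<subseteq> (\<Union>j. Y j)" "A' \<subseteq> space X - N"
    using A N' sets.sets_into_space[OF A] by (auto simp: A'_def N'_def)
  obtain j where j: "\<And>n. norm (simple_int X m (A' - Y j) (u n)) \<le> e / 4"
    using simple_int_uniform_tail[OF sf conv A'(1) _ Y(2) A'(2), of "e / 4"] Y(1) e by auto
  define A2 where "A2 = A' \<inter> Y j"
  have A2: "A2 \<in> sets X" using A' Y by (auto simp: A2_def)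
  define c where "c = enn2real (semivariation X E m (Y j))"
  have c: "c \<ge> 0" by (simp add: c_def)
  define d where "d = e / (4 * (c + 1))"
  have d: "d > 0" "d * c \<le> e / 4" using e c by (auto simp: d_def field_simps)
  define B where "B k = {x\<in>A2. \<forall>n\<ge>k. norm (u n x) \<le> d}" for k
  have Bs: "B k \<in> sets X" for k
    unfolding B_def by (intro sets_Collect_all_ge A2 sets_Collect_simple_function sf)
  have BA: "B k \<subseteq> A2" for k by (auto simp: B_def)
  have "incseq B" by (auto simp: incseq_def B_def)
  moreover have "A2 \<subseteq> (\<Union>k. B k)"
  proof
    fix x assume x: "x \<in> A2"
    then have "(\<lambda>n. u n x) \<longlonglongrightarrow> 0" using A' by (intro lim) (auto simp: A2_def)
    from LIMSEQ_D[OF this d(1)] obtain k where "\<forall>n\<ge>k. norm (u n x) < d" by auto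
    with x show "x \<in> (\<Union>k. B k)" by (auto simp: B_def intro!: exI[of _ k] less_imp_le)
  qed
  ultimately obtain k where k: "\<And>n. norm (simple_int X m (A2 - B k) (u n)) \<le> e / 4"
    using simple_int_uniform_tail[where B = B, OF sf conv A2 Bs, where e = "e / 4"] e by auto
  have "norm (simple_int X m A (u n) - 0) < e" if n: "n \<ge> k" for n
  proof -
    have "simple_int X m A (u n) = simple_int X m A' (u n) + simple_int X m (A - A') (u n)"
      using A A' by (intro simple_int_split sf) (auto simp: A'_def)
    moreover have "simple_int X m (A - A') (u n) = 0"
      using A A' by (intro simple_int_null[OF u _ _ N'(2)]) (auto simp: A'_def)
    moreover have "simple_int X m A' (u n) = simple_int X m A2 (u n) + simple_int X m (A' - A2) (u n)"
      using A2 A' by (intro simple_int_split sf) (auto simp: A2_def)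
    moreover have "A' - A2 = A' - Y j" by (auto simp: A2_def)
    moreover have "simple_int X m A2 (u n) = simple_int X m (B k) (u n) + simple_int X m (A2 - B k) (u n)"
      by (intro simple_int_split sf A2 Bs BA)
    ultimately have eq: "simple_int X m A (u n) = simple_int X m (B k) (u n)
        + simple_int X m (A2 - B k) (u n) + simple_int X m (A' - Y j) (u n)" by simp
    have "norm (simple_int X m (B k) (u n)) \<le> d * c"
      unfolding c_def using n d
      by (intro simple_int_bound[OF u Bs _ _ _ Y(3)]) (auto simp: B_def A2_def)
    then show ?thesis
      unfolding eq using j[of n] k[of n] d(2) e
        norm_triangle_ineq[of "simple_int X m (B k) (u n)" "simple_int X m (A2 - B k) (u n)"]
        norm_triangle_ineq[of "simple_int X m (B k) (u n) + simple_int X m (A2 - B k) (u n)"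
          "simple_int X m (A' - Y j) (u n)"]
      by simp
  qed
  then show "\<exists>k. \<forall>n\<ge>k. norm (simple_int X m A (u n) - 0) < e" by blast
qed

lemma dobrakov_seq_diff:
  assumes s: "dobrakov_seq X E m f s" and t: "dobrakov_seq X E m h t"
  shows "dobrakov_seq X E m (\<lambda>x. f x - h x) (\<lambda>n x. s n x - t n x)"
  unfolding dobrakov_seq_def
proof (intro conjI allI ballI)
  have st: "s n \<in> simple_fun X E" "t n \<in> simple_fun X E" for n
    using s t by (auto simp: dobrakov_seq_def)
  then show "(\<lambda>x. s n x - t n x) \<in> simple_fun X E" for n by (intro simple_fun_diff subspace_E)
  obtain N1 N2 where "N1 \<in> sets X" "N2 \<in> sets X"
    "semivariation X E m N1 = 0" "semivariation X E m N2 = 0"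
    "\<And>x. x \<in> space X - N1 \<Longrightarrow> (\<lambda>n. s n x) \<longlonglongrightarrow> f x" "\<And>x. x \<in> space X - N2 \<Longrightarrow> (\<lambda>n. t n x) \<longlonglongrightarrow> h x"
    using s t unfolding dobrakov_seq_def ae_semivar_def by blast
  then show "ae_semivar X (semivariation X E m) (\<lambda>x. (\<lambda>n. s n x - t n x) \<longlonglongrightarrow> f x - h x)"
    unfolding ae_semivar_def
    by (intro bexI[of _ "N1 \<union> N2"]) (auto intro!: semivariation_Un_null tendsto_diff)
  show "convergent (\<lambda>n. simple_int X m A (\<lambda>x. s n x - t n x))" if "A \<in> sets X" for A
    using s t that st[THEN simple_fun_simple_function]
    by (simp add: simple_int_diff dobrakov_seq_def convergent_diff)
qed

lemma dobrakov_integral_eqI: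
  assumes s: "dobrakov_seq X E m f s" and A: "A \<in> sets X"
    and I: "(\<lambda>n. simple_int X m A (s n)) \<longlonglongrightarrow> I"
  shows "dobrakov_integral X E m A f = I"
  unfolding dobrakov_integral_def
proof (rule the_equality)
  show "\<exists>s. dobrakov_seq X E m f s \<and> (\<lambda>n. simple_int X m A (s n)) \<longlonglongrightarrow> I" using s I by blast
next
  fix J assume "\<exists>s. dobrakov_seq X E m f s \<and> (\<lambda>n. simple_int X m A (s n)) \<longlonglongrightarrow> J"
  then obtain t where t: "dobrakov_seq X E m f t" "(\<lambda>n. simple_int X m A (t n)) \<longlonglongrightarrow> J" by blast
  have st: "simple_function X (s n)" "simple_function X (t n)" for n
    using s t by (auto simp: dobrakov_seq_def simple_fun_def)
  have "(\<lambda>n. simple_int X m A (\<lambda>x. s n x - t n x)) \<longlonglongrightarrow> 0"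
    using dobrakov_seq_diff[OF s t(1)] A unfolding dobrakov_seq_def ae_semivar_def
    by (auto intro: simple_int_tendsto_zero)
  then have "(\<lambda>n. simple_int X m A (s n) - simple_int X m A (t n)) \<longlonglongrightarrow> 0"
    using A st by (simp add: simple_int_diff)
  moreover have "(\<lambda>n. simple_int X m A (s n) - simple_int X m A (t n)) \<longlonglongrightarrow> I - J"
    by (intro tendsto_diff I t)
  ultimately have "I - J = 0" by (rule LIMSEQ_unique[rotated])
  then show "J = I" by simp
qed

lemma dobrakov_integral_tendsto:
  assumes s: "dobrakov_seq X E m f s" and A: "A \<in> sets X"
  shows "(\<lambda>n. simple_int X m A (s n)) \<longlonglongrightarrow> dobrakov_integral X E m A f"
proof -
  obtain I where "(\<lambda>n. simple_int X m A (s n)) \<longlonglongrightarrow> I"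
    using s A by (auto simp: dobrakov_seq_def convergent_def)
  with dobrakov_integral_eqI[OF s A this] show ?thesis by simp
qed

lemma dobrakov_seq_simple:
  assumes "s \<in> simple_fun X E"
  shows "dobrakov_seq X E m s (\<lambda>_. s)"
  unfolding dobrakov_seq_def ae_semivar_def
  using assms by (auto intro!: bexI[of _ "{}"] convergent_const semivariation_eq_0I simp: CA_empty[OF ca])

lemma dobrakov_integral_simple:
  assumes "s \<in> simple_fun X E" "A \<in> sets X"
  shows "dobrakov_integral X E m A s = simple_int X m A s"
  using dobrakov_seq_simple assms by (intro dobrakov_integral_eqI) auto

lemma dobrakov_integral_diff:
  assumes s: "dobrakov_seq X E m f s" and t: "dobrakov_seq X E m h t" and A: "A \<in> sets X"
  shows "dobrakov_integral X E m A (\<lambda>x. f x - h x)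
    = dobrakov_integral X E m A f - dobrakov_integral X E m A h"
proof (rule dobrakov_integral_eqI[OF dobrakov_seq_diff[OF s t] A])
  have st: "simple_function X (s n)" "simple_function X (t n)" for n
    using s t by (auto simp: dobrakov_seq_def simple_fun_def)
  show "(\<lambda>n. simple_int X m A (\<lambda>x. s n x - t n x))
    \<longlonglongrightarrow> dobrakov_integral X E m A f - dobrakov_integral X E m A h"
    using tendsto_diff[OF dobrakov_integral_tendsto[OF s A] dobrakov_integral_tendsto[OF t A]] st A
    by (simp add: simple_int_diff)
qed

lemma dobrakov_integral_split:
  assumes s: "dobrakov_seq X E m f s" and AB: "A \<in> sets X" "B \<in> sets X" "B \<subseteq> A"
  shows "dobrakov_integral X E m A f = dobrakov_integral X E m B f + dobrakov_integral X E m (A - B) f"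
proof (rule dobrakov_integral_eqI[OF s AB(1)])
  have "simple_function X (s n)" for n using s by (auto simp: dobrakov_seq_def simple_fun_def)
  then have "simple_int X m A (s n) = simple_int X m B (s n) + simple_int X m (A - B) (s n)" for n
    using AB by (intro simple_int_split) auto
  then show "(\<lambda>n. simple_int X m A (s n))
      \<longlonglongrightarrow> dobrakov_integral X E m B f + dobrakov_integral X E m (A - B) f"
    using AB by (simp add: tendsto_add dobrakov_integral_tendsto[OF s])
qed

lemma dobrakov_integral_null:
  assumes s: "dobrakov_seq X E m f s" and A: "A \<in> sets X" "semivariation X E m A = 0"
  shows "dobrakov_integral X E m A f = 0"
proof (rule dobrakov_integral_eqI[OF s A(1)])
  have "simple_int X m A (s n) = 0" for n
    using s A by (intro simple_int_null[of _ _ A]) (auto simp: dobrakov_seq_def)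
  then show "(\<lambda>n. simple_int X m A (s n)) \<longlonglongrightarrow> 0" by simp
qed

end

sublocale finite_operator_measure \<subseteq> sigma_finite_operator_measure
proof
  show "\<exists>Y::nat \<Rightarrow> 'a set. range Y \<subseteq> sets X \<and> incseq Y \<and>
    (\<forall>j. semivariation X E m (Y j) < \<infinity>) \<and> semivariation X E m (space X - (\<Union>j. Y j)) = 0"
    using finite by (intro exI[of _ "\<lambda>_. space X"])
      (auto simp: incseq_def CA_empty[OF ca] intro!: semivariation_eq_0I)
qed

section \<open>Domination by the semivariation\<close>

lemma ennreal_powr_1 [simp]: "ennreal_powr a 1 = a"
  by (cases a) (auto simp: ennreal_powr_def)

lemma p_semivar_ennreal_1_upper:
  assumes "s \<in> simple_fun X E" "\<And>x. x \<in> space X \<Longrightarrow> ennreal (norm (s x)) \<le> \<phi> x"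
  shows "ennreal (norm (simple_int X m A s)) \<le> p_semivar_ennreal X E m 1 \<phi> A"
  unfolding p_semivar_ennreal_def
  using assms by (intro Sup_upper CollectI exI[of _ s]) auto

lemma norm_triangle_4:
  fixes p q r s :: "'g::real_normed_vector"
  shows "norm (p + q + r - s) \<le> norm p + norm q + norm r + norm s"
  using norm_triangle_ineq4[of "p + q + r" s] norm_triangle_ineq[of "p + q" r] norm_triangle_ineq[of p q]
  by linarith

context finite_operator_measure
begin

text \<open>
  The indefinite integral of \<open>f\<close> is dominated by the semivariation of \<open>|f|\<close>. The approximants
  \<open>t k\<close> of \<open>f\<close> are turned into competitors for the supremum by shortening their values by the
  uniform error \<open>d\<close> on the set where this error has been reached.
\<close>

lemma norm_dobrakov_integral_le:
  assumes t: "dobrakov_seq X E m f t" and A: "A \<in> sets X"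
    and \<phi>: "\<And>x. x \<in> space X \<Longrightarrow> ennreal (norm (f x)) \<le> \<phi> x"
  shows "ennreal (norm (dobrakov_integral X E m A f)) \<le> p_semivar_ennreal X E m 1 \<phi> A"
proof (rule ennreal_le_epsilon)
  fix e :: real assume e: "e > 0"
  let ?I = "dobrakov_integral X E m A f"
  have tE: "t n \<in> simple_fun X E" for n using t by (simp add: dobrakov_seq_def)
  have sf: "simple_function X (t n)" for n using tE by (rule simple_fun_simple_function)
  have conv: "convergent (\<lambda>n. simple_int X m A (t n))" if "A \<in> sets X" for A
    using t that by (auto simp: dobrakov_seq_def)
  obtain N where N: "N \<in> sets X" "semivariation X E m N = 0"
    and lim: "\<And>x. x \<in> space X - N \<Longrightarrow> (\<lambda>n. t n x) \<longlonglongrightarrow> f x"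
    using t by (auto simp: dobrakov_seq_def ae_semivar_def)
  define c where "c = enn2real (semivariation X E m (space X))"
  define d where "d = e / (3 * (c + 1))"
  have "c \<ge> 0" by (simp add: c_def)
  with e have d: "d > 0" "d * c \<le> e / 3" by (auto simp: d_def field_simps)
  define A' where "A' = A - N"
  have A': "A' \<in> sets X" "A' \<subseteq> A" "A' \<subseteq> space X - N"
    using A N sets.sets_into_space[OF A] by (auto simp: A'_def)
  define B where "B k = {x\<in>A'. \<forall>n\<ge>k. \<forall>l\<ge>k. norm (t n x - t l x) \<le> d}" for k
  have Bs: "B k \<in> sets X" for k
    unfolding B_def
    by (intro sets_Collect_all_ge A' sets.top sets_Collect_simple_function[where P = "\<lambda>y. norm y \<le> d"]
        simple_function_compose2[where h = minus] sf)
  have BA: "B k \<subseteq> A'" for k by (auto simp: B_def)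
  have "incseq B" by (auto simp: incseq_def B_def)
  moreover have "A' \<subseteq> (\<Union>k. B k)"
  proof
    fix x assume x: "x \<in> A'"
    then have "Cauchy (\<lambda>n. t n x)" using A' by (intro LIMSEQ_imp_Cauchy[OF lim]) auto
    from CauchyD[OF this d(1)] obtain k where "\<forall>n\<ge>k. \<forall>l\<ge>k. norm (t n x - t l x) < d" by blast
    with x have "x \<in> B k" by (auto simp: B_def less_imp_le)
    then show "x \<in> (\<Union>k. B k)" by blast
  qed
  ultimately obtain K where K: "\<And>k n. k \<ge> K \<Longrightarrow> norm (simple_int X m (A' - B k) (t n)) \<le> e / 3"
    using simple_int_uniform_tail[where B = B, OF sf conv A'(1) Bs, where e = "e / 3"] e by auto
  obtain k where k: "k \<ge> K" "norm (simple_int X m A (t k) - ?I) < e / 3"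
    using LIMSEQ_D[OF dobrakov_integral_tendsto[OF t A], of "e / 3"] e
    by (metis divide_pos_pos nle_le zero_less_numeral)
  \<comment> \<open>On \<open>B k\<close> the error \<open>norm (t k x - f x)\<close> is at most \<open>d\<close>, hence \<open>norm (u x) \<le> norm (f x)\<close> there.\<close>
  define u where "u x = (if x \<in> B k then (max 0 (norm (t k x) - d) / norm (t k x)) *\<^sub>R t k x else 0)" for x
  have u_sf: "simple_function X u"
    unfolding u_def
  proof (rule simple_function_If_set)
    show "simple_function X (\<lambda>x. (max 0 (norm (t k x) - d) / norm (t k x)) *\<^sub>R t k x)"
      by (rule simple_function_compose1[OF sf, where g = "\<lambda>y. (max 0 (norm y - d) / norm y) *\<^sub>R y"])
    show "B k \<inter> space X \<in> sets X" using Bs by blast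
  qed simp
  have u: "u \<in> simple_fun X E"
    using u_sf tE[of k] subspace_E
    by (auto simp: simple_fun_def u_def Pi_iff subspace_scale subspace_0)
  have "ennreal (norm (u x)) \<le> \<phi> x" if x: "x \<in> space X" for x
  proof -
    have "norm (u x) \<le> norm (f x)"
    proof (cases "x \<in> B k")
      case True
      have "(\<lambda>n. norm (t k x - t n x)) \<longlonglongrightarrow> norm (t k x - f x)"
        using True A' by (intro tendsto_norm tendsto_diff tendsto_const lim) (auto simp: B_def)
      moreover have "\<forall>n\<ge>k. norm (t k x - t n x) \<le> d" using True by (auto simp: B_def)
      ultimately have "norm (t k x - f x) \<le> d" by (intro LIMSEQ_le_const2) auto
      then have "norm (t k x) - d \<le> norm (f x)"
        using norm_triangle_ineq2[of "t k x" "f x"] by linarith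
      then show ?thesis using True by (simp add: u_def)
    qed (simp add: u_def)
    then show ?thesis using \<phi>[OF x] by (meson ennreal_leI order_trans)
  qed
  then have upper: "ennreal (norm (simple_int X m A u)) \<le> p_semivar_ennreal X E m 1 \<phi> A"
    by (intro p_semivar_ennreal_1_upper u)
  have "simple_int X m A u = simple_int X m (B k) u + simple_int X m (A - B k) u"
    using A'(2) BA by (intro simple_int_split u_sf A Bs) blast
  moreover have "simple_int X m (A - B k) u = 0" by (intro simple_int_eq_0) (auto simp: u_def)
  ultimately have 1: "simple_int X m A u = simple_int X m (B k) u" by simp
  have "simple_int X m A (t k) = simple_int X m A' (t k) + simple_int X m (A - A') (t k)"
    using A A' by (intro simple_int_split sf) auto
  moreover have "simple_int X m (A - A') (t k) = 0"
    using A A' by (intro simple_int_null[OF tE _ _ N(2)]) (auto simp: A'_def)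
  moreover have "simple_int X m A' (t k) = simple_int X m (B k) (t k) + simple_int X m (A' - B k) (t k)"
    by (intro simple_int_split sf A' Bs BA)
  ultimately have 2: "simple_int X m A (t k)
      = simple_int X m (B k) (t k) + simple_int X m (A' - B k) (t k)" by simp
  have "norm (simple_int X m (B k) (\<lambda>x. t k x - u x)) \<le> d * c"
    unfolding c_def
  proof (rule simple_int_bound[OF simple_fun_diff[OF subspace_E tE u] Bs _ d(1) _ finite])
    show "B k \<subseteq> space X" using sets.sets_into_space[OF Bs] .
    fix x assume x: "x \<in> B k"
    show "norm (t k x - u x) \<le> d"
    proof (cases "t k x = 0")
      case False
      have "t k x - u x = (1 - max 0 (norm (t k x) - d) / norm (t k x)) *\<^sub>R t k x"
        using x by (simp add: u_def scaleR_diff_left)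
      then have "norm (t k x - u x) = \<bar>1 - max 0 (norm (t k x) - d) / norm (t k x)\<bar> * norm (t k x)"
        by simp
      also have "\<dots> \<le> d"
      proof (cases "norm (t k x) \<le> d")
        case True
        then show ?thesis by simp
      next
        case f: False
        then have "1 - max 0 (norm (t k x) - d) / norm (t k x) = d / norm (t k x)"
          using False by (simp add: diff_divide_distrib)
        then show ?thesis using False d(1) by simp
      qed
      finally show ?thesis .
    qed (use d in \<open>simp add: u_def\<close>)
  qed
  then have 3: "norm (simple_int X m (B k) (t k) - simple_int X m (B k) u) \<le> e / 3"
    using simple_int_diff[OF sf u_sf Bs] d(2) by simp
  define a where "a = simple_int X m (B k) (t k)"
  define b where "b = simple_int X m (A' - B k) (t k)"
  have "?I = simple_int X m A u + (a - simple_int X m (B k) u) + b - (simple_int X m A (t k) - ?I)"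
    by (simp add: 1 2 a_def b_def)
  then have "norm ?I \<le> norm (simple_int X m A u) + norm (a - simple_int X m (B k) u) + norm b
      + norm (simple_int X m A (t k) - ?I)"
    by (metis norm_triangle_4)
  also have "\<dots> \<le> norm (simple_int X m A u) + e"
    using 3 k(2) K[OF k(1), of k] unfolding a_def b_def by simp
  finally have "ennreal (norm ?I) \<le> ennreal (norm (simple_int X m A u)) + ennreal e"
    using e by (simp add: ennreal_plus[symmetric] del: ennreal_plus)
  also have "\<dots> \<le> p_semivar_ennreal X E m 1 \<phi> A + ennreal e"
    by (intro add_right_mono upper)
  finally show "ennreal (norm ?I) \<le> p_semivar_ennreal X E m 1 \<phi> A + ennreal e" .
qed

lemma norm_dobrakov_integral_le_const:
  assumes t: "dobrakov_seq X E m f t" and A: "A \<in> sets X"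
    and C: "C > 0" "\<And>x. x \<in> A \<Longrightarrow> norm (f x) \<le> C"
  shows "norm (dobrakov_integral X E m A f) \<le> C * enn2real (semivariation X E m (space X))"
proof -
  let ?\<phi> = "\<lambda>x. if x \<in> A then ennreal C else \<infinity>"
  have "ennreal (norm (dobrakov_integral X E m A f)) \<le> p_semivar_ennreal X E m 1 ?\<phi> A"
    using C by (intro norm_dobrakov_integral_le[OF t A]) (auto intro: ennreal_leI)
  also have "\<dots> \<le> ennreal (C * enn2real (semivariation X E m (space X)))"
    unfolding p_semivar_ennreal_def
  proof (intro Sup_least, elim CollectE exE conjE)
    fix y s
    assume y: "y = ennreal (norm (simple_int X m A s) powr (1 / 1))" and s: "s \<in> simple_fun X E"
      and le: "\<forall>x\<in>space X. ennreal (norm (s x)) \<le> ennreal_powr (?\<phi> x) 1"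
    have "norm (s x) \<le> C" if "x \<in> A" for x
      using le[rule_format, of x] that sets.sets_into_space[OF A] C by (auto simp: ennreal_le_iff)
    then have "norm (simple_int X m A s) \<le> C * enn2real (semivariation X E m (space X))"
      using sets.sets_into_space[OF A] by (intro simple_int_bound[OF s A _ C(1) _ finite]) auto
    then show "y \<le> ennreal (C * enn2real (semivariation X E m (space X)))"
      by (simp add: y ennreal_leI)
  qed
  finally show ?thesis using C by (simp add: ennreal_le_iff)
qed

text \<open>
  Dominated convergence: the integrals over each set converge if the semivariation of the
  majorant \<open>\<phi>\<close> is continuous at the empty set. One null set \<open>N\<close> serves all the functions \<open>h n\<close>,
  which makes the sets where \<open>h n\<close> and \<open>h l\<close> are close measurable off \<open>N\<close>.
\<close>

lemma dobrakov_integral_dominated_Cauchy: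
  assumes N: "N \<in> sets X" "semivariation X E m N = 0"
    and seq: "\<And>n::nat. dobrakov_seq X E m (h n) (t n)"
    and t: "\<And>n x. x \<in> space X - N \<Longrightarrow> (\<lambda>i. t n i x) \<longlonglongrightarrow> h n x"
    and lim: "\<And>x. x \<in> space X - N \<Longrightarrow> (\<lambda>n. h n x) \<longlonglongrightarrow> h' x"
    and dom: "\<And>n x. x \<in> space X \<Longrightarrow> ennreal (norm (h n x)) \<le> \<phi> x"
    and \<phi>: "\<And>A::nat \<Rightarrow> 'a set. range A \<subseteq> sets X \<Longrightarrow> decseq A \<Longrightarrow> (\<Inter>n. A n) = {} \<Longrightarrow>
       (\<lambda>n. p_semivar_ennreal X E m 1 \<phi> (A n)) \<longlonglongrightarrow> 0"
    and A: "A \<in> sets X"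
  shows "Cauchy (\<lambda>n. dobrakov_integral X E m A (h n))"
proof (rule CauchyI)
  fix e :: real assume e: "e > 0"
  let ?I = "\<lambda>A n. dobrakov_integral X E m A (h n)"
  have sf: "simple_function X (t n i)" for n i
    using seq[of n] by (auto simp: dobrakov_seq_def simple_fun_def)
  define c where "c = enn2real (semivariation X E m (space X))"
  define d where "d = e / (4 * (c + 1))"
  have "c \<ge> 0" by (simp add: c_def)
  with e have d: "d > 0" "d * c \<le> e / 4" by (auto simp: d_def field_simps)
  define A' where "A' = A - N"
  have A': "A' \<in> sets X" "A' \<subseteq> A" "A' \<subseteq> space X - N"
    using A N sets.sets_into_space[OF A] by (auto simp: A'_def)
  define w where "w n l x = indicator (space X - N) x * norm (h n x - h l x)" for n l x
  have w: "w n l \<in> borel_measurable X" for n l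
  proof (rule borel_measurable_LIMSEQ_real)
    show "(\<lambda>i. indicator (space X - N) x * norm (t n i x - t l i x)) \<longlonglongrightarrow> w n l x"
      if "x \<in> space X" for x
      using t that by (cases "x \<in> N") (auto simp: w_def intro!: tendsto_intros)
    show "(\<lambda>x. indicator (space X - N) x * norm (t n i x - t l i x)) \<in> borel_measurable X" for i
      using N sf by (intro borel_measurable_simple_function simple_function_mult
          simple_function_indicator simple_function_compose1[where g = norm]
          simple_function_compose2[where h = minus]) auto
  qed
  define B where "B k = {x\<in>A'. \<forall>n\<ge>k. \<forall>l\<ge>k. w n l x \<le> d}" for k
  have Bs: "B k \<in> sets X" for k
    unfolding B_def by (intro sets_Collect_all_ge A' sets.top borel_measurable_le w borel_measurable_const)
  have BA: "B k \<subseteq> A'" for k by (auto simp: B_def)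
  have wA': "w n l x = norm (h n x - h l x)" if "x \<in> A'" for n l x
    using that A' by (auto simp: w_def)
  have "(\<lambda>k. p_semivar_ennreal X E m 1 \<phi> (A' - B k)) \<longlonglongrightarrow> 0"
  proof (rule \<phi>)
    show "range (\<lambda>k. A' - B k) \<subseteq> sets X" using A' Bs by auto
    show "decseq (\<lambda>k. A' - B k)" by (auto simp: decseq_def B_def)
    show "(\<Inter>k. A' - B k) = {}"
    proof -
      have "\<exists>k. x \<in> B k" if x: "x \<in> A'" for x
      proof -
        have "Cauchy (\<lambda>n. h n x)" using x A' by (intro LIMSEQ_imp_Cauchy[OF lim]) auto
        from CauchyD[OF this d(1)] obtain k
          where "\<forall>n\<ge>k. \<forall>l\<ge>k. norm (h n x - h l x) < d" by blast
        with x have "x \<in> B k" by (auto simp: B_def less_imp_le wA')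
        then show ?thesis by blast
      qed
      then show ?thesis by blast
    qed
  qed
  then have "\<forall>\<^sub>F k in sequentially. p_semivar_ennreal X E m 1 \<phi> (A' - B k) < ennreal (e / 4)"
    using e by (intro order_tendstoD(2)) auto
  then obtain k where k: "p_semivar_ennreal X E m 1 \<phi> (A' - B k) < ennreal (e / 4)"
    by (auto simp: eventually_sequentially)
  have small: "norm (?I (A' - B k) n) < e / 4" for n
  proof -
    have "ennreal (norm (?I (A' - B k) n)) \<le> p_semivar_ennreal X E m 1 \<phi> (A' - B k)"
      using A' Bs dom by (intro norm_dobrakov_integral_le[OF seq]) auto
    with k show ?thesis using e by (metis ennreal_less_iff norm_ge_zero order_le_less_trans)
  qed
  have split: "?I A n = ?I (B k) n + ?I (A' - B k) n" for n
  proof -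
    have "?I A n = ?I A' n + ?I (A - A') n"
      using A A' by (intro dobrakov_integral_split[OF seq]) auto
    moreover have "semivariation X E m (A - A') \<le> semivariation X E m N"
      by (intro semivariation_mono) (auto simp: A'_def)
    then have "?I (A - A') n = 0"
      using A A' N by (intro dobrakov_integral_null[OF seq]) auto
    moreover have "?I A' n = ?I (B k) n + ?I (A' - B k) n"
      by (intro dobrakov_integral_split[OF seq] A' Bs BA)
    ultimately show ?thesis by simp
  qed
  have "norm (?I A n - ?I A l) < e" if "n \<ge> k" "l \<ge> k" for n l
  proof -
    have "norm (dobrakov_integral X E m (B k) (\<lambda>x. h n x - h l x)) \<le> d * c"
      unfolding c_def
    proof (rule norm_dobrakov_integral_le_const[OF dobrakov_seq_diff[OF seq seq] Bs d(1)])
      fix x assume "x \<in> B k"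
      with that wA' show "norm (h n x - h l x) \<le> d" by (auto simp: B_def)
    qed
    then have le: "norm (?I (B k) n - ?I (B k) l) \<le> e / 4"
      using dobrakov_integral_diff[OF seq seq Bs] d(2) by simp
    have "?I A n - ?I A l = (?I (B k) n - ?I (B k) l) + (?I (A' - B k) n - ?I (A' - B k) l)"
      by (simp add: split)
    then have "norm (?I A n - ?I A l)
        \<le> norm (?I (B k) n - ?I (B k) l) + norm (?I (A' - B k) n - ?I (A' - B k) l)"
      by (metis norm_triangle_ineq)
    then show ?thesis
      using norm_triangle_ineq4[of "?I (A' - B k) n" "?I (A' - B k) l"] le small[of n] small[of l] e
      by linarith
  qed
  then show "\<exists>M. \<forall>n\<ge>M. \<forall>l\<ge>M. norm (?I A n - ?I A l) < e" by blast
qed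

end

section \<open>Simple functions below a strongly measurable function\<close>

text \<open>
  Simple approximants \<open>s n\<close> are cut down to norm at most \<open>q n\<close>, where the real simple functions
  \<open>q n\<close> increase to \<open>|f|\<close> off \<open>N\<close> and vanish on \<open>N\<close>.
\<close>

lemma simple_approximation_below:
  fixes f :: "'x \<Rightarrow> 'e::banach"
  assumes E: "subspace E" and N: "N \<in> sets X"
    and s: "\<And>n::nat. s n \<in> simple_fun X E"
    and lim: "\<And>x. x \<in> space X - N \<Longrightarrow> (\<lambda>n. s n x) \<longlonglongrightarrow> f x"
  shows "\<exists>s'. (\<forall>n::nat. s' n \<in> simple_fun X E) \<and>
    (\<forall>n. \<forall>x\<in>space X. norm (s' n x) \<le> norm (f x)) \<and>
    (\<forall>x\<in>space X - N. (\<lambda>n. s' n x) \<longlonglongrightarrow> f x)"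
proof -
  have sf: "simple_function X (s n)" for n using s by (rule simple_fun_simple_function)
  define r where "r x = indicator (space X - N) x * norm (f x)" for x
  have "r \<in> borel_measurable X"
  proof (rule borel_measurable_LIMSEQ_real)
    show "(\<lambda>i. indicator (space X - N) x * norm (s i x)) \<longlonglongrightarrow> r x" if "x \<in> space X" for x
      using lim that by (cases "x \<in> N") (auto simp: r_def intro!: tendsto_intros)
    show "(\<lambda>x. indicator (space X - N) x * norm (s i x)) \<in> borel_measurable X" for i
      using N sf by (intro borel_measurable_simple_function simple_function_mult
          simple_function_indicator simple_function_compose1[where g = norm]) auto
  qed
  then have "(\<lambda>x. ennreal (r x)) \<in> borel_measurable X" by simp
  then obtain U where U: "\<And>i. simple_function X (U i)" "incseq U" "\<And>i x. U i x < top"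
    "\<And>x. (SUP i. U i x) = ennreal (r x)"
    using borel_measurable_implies_simple_function_sequence' by blast
  define q where "q i x = enn2real (U i x)" for i :: nat and x
  have r0: "0 \<le> r x" for x by (simp add: r_def)
  have q0: "0 \<le> q i x" for i x by (simp add: q_def)
  have q_le: "q i x \<le> r x" for i x
  proof -
    have "U i x \<le> ennreal (r x)" unfolding U(4)[symmetric] by (intro SUP_upper) simp
    then show ?thesis unfolding q_def using enn2real_mono[of "U i x" "ennreal (r x)"] r0 by simp
  qed
  have q_lim: "(\<lambda>i. q i x) \<longlonglongrightarrow> r x" for x
  proof -
    have "(\<lambda>i. U i x) \<longlonglongrightarrow> (SUP i. U i x)"
      using U(2) by (intro LIMSEQ_SUP) (auto simp: incseq_def le_fun_def)
    then show ?thesis unfolding q_def U(4) using r0 by (intro tendsto_enn2real) auto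
  qed
  define s' where "s' n x = min 1 (q n x / norm (s n x)) *\<^sub>R s n x" for n x
  have le: "norm (s' n x) \<le> q n x" for n x
    using q0[of n x] by (cases "s n x = 0") (auto simp: s'_def min_def field_simps)
  show ?thesis
  proof (intro exI[of _ s'] conjI allI ballI)
    show "s' n \<in> simple_fun X E" for n
    proof -
      have "simple_function X (\<lambda>x. enn2real (U n x))"
        by (rule simple_function_compose1[OF U(1)])
      then have "simple_function X (\<lambda>x. min 1 (enn2real (U n x) / norm (s n x)) *\<^sub>R s n x)"
        by (rule simple_function_compose2[OF _ sf, where h = "\<lambda>a b. min 1 (a / norm b) *\<^sub>R b"])
      moreover have "s' n x \<in> E" if "x \<in> space X" for x
        unfolding s'_def using simple_fun_mem[OF s that] E by (rule subspace_scale[rotated])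
      ultimately show ?thesis by (auto simp: simple_fun_def s'_def[abs_def] q_def)
    qed
    show "norm (s' n x) \<le> norm (f x)" for n x
      using le[of n x] q_le[of n x]
      by (cases "x \<in> space X - N") (auto simp: r_def intro: order_trans)
    fix x assume x: "x \<in> space X - N"
    then have rx: "r x = norm (f x)" by (simp add: r_def)
    show "(\<lambda>n. s' n x) \<longlonglongrightarrow> f x"
    proof (cases "f x = 0")
      case True
      with le[of _ x] q_le[of _ x] rx have "s' n x = 0" for n
        by (metis norm_le_zero_iff norm_zero order_trans)
      with True show ?thesis by simp
    next
      case False
      have "(\<lambda>n. min 1 (q n x / norm (s n x)) *\<^sub>R s n x) \<longlonglongrightarrow> min 1 (r x / norm (f x)) *\<^sub>R f x"
        using False by (intro tendsto_intros lim x q_lim) auto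
      with False rx show ?thesis by (simp add: s'_def)
    qed
  qed
qed

section \<open>The Hahn--Banach theorem and operators of rank one\<close>

text \<open>
  Sublinear functionals. Only the inequality \<open>\<le>\<close> is required for positive factors; equality follows.
\<close>

definition sublinear :: "('a::real_vector \<Rightarrow> real) \<Rightarrow> bool" where
  "sublinear p \<longleftrightarrow> (\<forall>x y. p (x + y) \<le> p x + p y) \<and> (\<forall>t>0. \<forall>x. p (t *\<^sub>R x) \<le> t * p x)"

lemma sublinear_add: "sublinear p \<Longrightarrow> p (x + y) \<le> p x + p y"
  by (simp add: sublinear_def)

lemma sublinear_zero:
  assumes "sublinear p"
  shows "p 0 = 0"
proof -
  have "p 0 \<le> (1/2) * p 0" using assms unfolding sublinear_def
    by (metis half_gt_zero_iff scaleR_zero_right zero_less_one)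
  moreover have "p 0 \<le> p 0 + p 0" using sublinear_add[OF assms, of 0 0] by simp
  ultimately show ?thesis by simp
qed

lemma sublinear_scale:
  assumes "sublinear p" "t \<ge> 0"
  shows "p (t *\<^sub>R x) = t * p x"
proof (cases "t = 0")
  case False
  with assms have t: "t > 0" by simp
  have "p x = p ((1/t) *\<^sub>R t *\<^sub>R x)" using t by simp
  also have "\<dots> \<le> (1/t) * p (t *\<^sub>R x)"
    using assms(1) t unfolding sublinear_def by (metis zero_less_divide_1_iff)
  finally have "t * p x \<le> p (t *\<^sub>R x)" using t by (simp add: field_simps)
  moreover have "p (t *\<^sub>R x) \<le> t * p x" using assms(1) t by (simp add: sublinear_def)
  ultimately show ?thesis by simp
qed (use assms in \<open>simp add: sublinear_zero\<close>)

lemma sublinear_minus_le: "sublinear p \<Longrightarrow> - p (- x) \<le> p x"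
  using sublinear_add[of p x "- x"] by (simp add: sublinear_zero)

lemma sublinear_norm: "sublinear norm"
  by (simp add: sublinear_def norm_triangle_ineq)

text \<open>
  For given \<open>y\<close>, every sublinear \<open>p\<close> can be lowered to some \<open>p'\<close> with \<open>p' x + p y \<le> p (x + y)\<close>.
  If \<open>p\<close> is minimal, then \<open>p' = p\<close>, so that \<open>p\<close> is additive.
\<close>

lemma sublinear_lower:
  assumes p: "sublinear p"
  shows "\<exists>p'. sublinear p' \<and> (\<forall>x. p' x \<le> p x) \<and> (\<forall>x. p' x \<le> p (x + y) - p y)"
proof -
  define F where "F x t = p (x + t *\<^sub>R y) - t * p y" for x t
  define p' where "p' x = (INF t\<in>{0..}. F x t)" for x
  have lower: "- p (- x) \<le> F x t" if "t \<ge> 0" for x t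
    using sublinear_add[OF p, of "- x" "x + t *\<^sub>R y"] sublinear_scale[OF p that, of y]
    by (simp add: F_def)
  have bdd: "bdd_below (F x ` {0..})" for x
    using lower by (intro bdd_belowI2[of _ "- p (- x)"]) auto
  have up: "p' x \<le> F x t" if "t \<ge> 0" for x t
    unfolding p'_def using that by (intro cINF_lower bdd) auto
  have great: "a \<le> p' x" if "\<And>t. t \<ge> 0 \<Longrightarrow> a \<le> F x t" for a x
    unfolding p'_def using that by (intro cINF_greatest) auto
  have "sublinear p'"
    unfolding sublinear_def
  proof (intro conjI allI impI)
    fix x z
    have "p' (x + z) - F z t2 \<le> F x t1" if t: "t1 \<ge> 0" "t2 \<ge> 0" for t1 t2
    proof -
      have "p' (x + z) \<le> F (x + z) (t1 + t2)" using t by (intro up) simp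
      also have "\<dots> \<le> F x t1 + F z t2"
        using sublinear_add[OF p, of "x + t1 *\<^sub>R y" "z + t2 *\<^sub>R y"]
        by (simp add: F_def algebra_simps)
      finally show ?thesis by simp
    qed
    then have "p' (x + z) - F z t2 \<le> p' x" if "t2 \<ge> 0" for t2 using that by (intro great) auto
    then have "p' (x + z) - p' x \<le> F z t2" if "t2 \<ge> 0" for t2 using that by (simp add: algebra_simps)
    then have "p' (x + z) - p' x \<le> p' z" by (rule great)
    then show "p' (x + z) \<le> p' x + p' z" by simp
  next
    fix t :: real and x assume t: "t > 0"
    have "p' (t *\<^sub>R x) / t \<le> F x a" if a: "a \<ge> 0" for a
    proof -
      have "p' (t *\<^sub>R x) \<le> F (t *\<^sub>R x) (t * a)" using a t by (intro up) simp
      also have "\<dots> = t * F x a"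
        using sublinear_scale[OF p, of t "x + a *\<^sub>R y"] t by (simp add: F_def algebra_simps)
      finally show ?thesis using t by (simp add: field_simps)
    qed
    then have "p' (t *\<^sub>R x) / t \<le> p' x" by (rule great)
    then show "p' (t *\<^sub>R x) \<le> t * p' x" using t by (simp add: field_simps)
  qed
  then show ?thesis using up[of 0] up[of 1] by (intro exI[of _ p']) (auto simp: F_def)
qed

text \<open>By Zorn's lemma, using pointwise infima of chains.\<close>

lemma sublinear_minimal:
  assumes q: "sublinear q"
  shows "\<exists>p. sublinear p \<and> (\<forall>x. p x \<le> q x) \<and>
    (\<forall>p'. sublinear p' \<longrightarrow> (\<forall>x. p' x \<le> p x) \<longrightarrow> p' = p)"
proof -
  define S where "S = {p. sublinear p \<and> (\<forall>x. p x \<le> q x)}"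
  define P where "P a b \<longleftrightarrow> (\<forall>x. b x \<le> (a x :: real))" for a b :: "'a \<Rightarrow> real"
  have "\<exists>p\<in>S. \<forall>a\<in>S. P p a \<longrightarrow> a = p"
  proof (rule predicate_Zorn)
    show "partial_order_on S (relation_of P S)"
      by (rule partial_order_on_relation_ofI)
        (auto simp: P_def fun_eq_iff intro: order_trans order_antisym)
    fix C assume C: "C \<in> Chains (relation_of P S)"
    then have CS: "C \<subseteq> S" and chain: "\<And>a b. a \<in> C \<Longrightarrow> b \<in> C \<Longrightarrow> P a b \<or> P b a"
      by (auto simp: Chains_def relation_of_def)
    show "\<exists>u\<in>S. \<forall>a\<in>C. P a u"
    proof (cases "C = {}")
      case True
      with q show ?thesis by (auto simp: S_def)
    next
      case False
      define u where "u x = (INF p\<in>C. p x)" for x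
      have lower: "- q (- x) \<le> p x" if "p \<in> C" for p x
        using CS that sublinear_minus_le[of p x] by (force simp: S_def intro: order_trans[rotated])
      have up: "u x \<le> p x" if "p \<in> C" for p x
        unfolding u_def using that lower
        by (intro cINF_lower bdd_belowI2[of _ "- q (- x)"]) auto
      have great: "a \<le> u x" if "\<And>p. p \<in> C \<Longrightarrow> a \<le> p x" for a x
        unfolding u_def using that False by (intro cINF_greatest) auto
      have "sublinear u"
        unfolding sublinear_def
      proof (intro conjI allI impI)
        fix x y
        have "u (x + y) - b y \<le> a x" if ab: "a \<in> C" "b \<in> C" for a b
        proof -
          obtain d where d: "d \<in> C" "d x \<le> a x" "d y \<le> b y"
            using chain[OF ab] ab by (auto simp: P_def)
          then have "u (x + y) \<le> d x + d y"
            using up[OF d(1), of "x + y"] CS sublinear_add[of d x y] by (force simp: S_def)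
          with d show ?thesis by simp
        qed
        then have "u (x + y) - b y \<le> u x" if "b \<in> C" for b using that by (intro great) auto
        then have "u (x + y) - u x \<le> b y" if "b \<in> C" for b using that by (simp add: algebra_simps)
        then have "u (x + y) - u x \<le> u y" by (rule great)
        then show "u (x + y) \<le> u x + u y" by simp
      next
        fix t :: real and x assume t: "t > 0"
        have "u (t *\<^sub>R x) / t \<le> a x" if a: "a \<in> C" for a
        proof -
          have "u (t *\<^sub>R x) \<le> a (t *\<^sub>R x)" by (rule up[OF a])
          also have "\<dots> = t * a x" using CS a t by (intro sublinear_scale) (auto simp: S_def)
          finally show ?thesis using t by (simp add: field_simps)
        qed
        then have "u (t *\<^sub>R x) / t \<le> u x" by (rule great)
        then show "u (t *\<^sub>R x) \<le> t * u x" using t by (simp add: field_simps)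
      qed
      moreover have "u x \<le> q x" for x
        using False CS up[of _ x] by (force simp: S_def intro: order_trans)
      ultimately show ?thesis using up by (intro bexI[of _ u]) (auto simp: S_def P_def)
    qed
  qed
  then obtain p where p: "p \<in> S" and min: "\<And>a. a \<in> S \<Longrightarrow> P p a \<Longrightarrow> a = p" by blast
  have "p' = p" if "sublinear p'" "\<forall>x. p' x \<le> p x" for p'
  proof (rule min)
    show "p' \<in> S" using that p by (auto simp: S_def intro: order_trans)
    show "P p p'" using that by (simp add: P_def)
  qed
  with p show ?thesis by (auto simp: S_def)
qed

text \<open>Hahn--Banach, in the form of the existence of a norming functional.\<close>

lemma norming_functional:
  fixes u :: "'a::real_normed_vector"
  shows "\<exists>\<phi>. linear \<phi> \<and> (\<forall>x. \<bar>\<phi> x\<bar> \<le> norm x) \<and> norm u \<le> \<phi> u"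
proof -
  obtain q where q: "sublinear q" "\<And>x. q x \<le> norm x" "\<And>x. q x \<le> norm (x + u) - norm u"
    using sublinear_lower[OF sublinear_norm, of u] by blast
  obtain p where p: "sublinear p" "\<And>x. p x \<le> q x"
    "\<And>p'. sublinear p' \<Longrightarrow> (\<forall>x. p' x \<le> p x) \<Longrightarrow> p' = p"
    using sublinear_minimal[OF q(1)] by blast
  have add: "p (x + y) = p x + p y" for x y
  proof (rule order_antisym)
    show "p (x + y) \<le> p x + p y" by (rule sublinear_add[OF p(1)])
    obtain p' where p': "sublinear p'" "\<forall>x. p' x \<le> p x" "\<And>x. p' x \<le> p (x + y) - p y"
      using sublinear_lower[OF p(1), of y] by blast
    then have "p' = p" using p(3) by blast
    with p'(3)[of x] show "p x + p y \<le> p (x + y)" by simp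
  qed
  have minus: "p (- x) = - p x" for x
    using add[of x "- x"] sublinear_zero[OF p(1)] by simp
  have "linear p"
  proof (rule linearI)
    fix r :: real and x
    show "p (r *\<^sub>R x) = r *\<^sub>R p x"
      using sublinear_scale[OF p(1), of r x] sublinear_scale[OF p(1), of "- r" x] minus[of "r *\<^sub>R x"]
      by (cases "r \<ge> 0") auto
  qed (rule add)
  moreover have "\<bar>p x\<bar> \<le> norm x" for x
    using p(2)[of x] p(2)[of "- x"] q(2)[of x] q(2)[of "- x"] minus[of x] by simp
  moreover have "norm u \<le> p u" using p(2)[of "- u"] q(3)[of "- u"] minus[of u] by simp
  ultimately show ?thesis by blast
qed

context
  fixes F :: "complex set" and sc :: "complex \<Rightarrow> 'v::banach \<Rightarrow> 'v"
  assumes F: "F = \<real> \<or> F = UNIV" and sc: "banach_over F sc"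
begin

lemma of_real_mem_scalars: "complex_of_real r \<in> F"
  using F by auto

lemma banach_over_scaleR: "sc (complex_of_real r) x = r *\<^sub>R x"
  using sc by (simp add: banach_over_def)

lemma banach_over_add_right: "a \<in> F \<Longrightarrow> sc a (x + y) = sc a x + sc a y"
  using sc by (simp add: banach_over_def)

lemma banach_over_add_left: "a \<in> F \<Longrightarrow> b \<in> F \<Longrightarrow> sc (a + b) x = sc a x + sc b x"
  using sc by (simp add: banach_over_def)

lemma banach_over_mult: "a \<in> F \<Longrightarrow> b \<in> F \<Longrightarrow> sc (a * b) x = sc a (sc b x)"
  using sc by (simp add: banach_over_def)

lemma banach_over_norm: "a \<in> F \<Longrightarrow> norm (sc a x) = cmod a * norm x"
  using sc by (simp add: banach_over_def)

lemma banach_over_zero: "a \<in> F \<Longrightarrow> sc a 0 = 0"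
  using banach_over_norm[of a 0] by simp

lemma banach_over_scaleR_commute: "a \<in> F \<Longrightarrow> sc a (r *\<^sub>R x) = r *\<^sub>R sc a x"
  using banach_over_mult[OF _ of_real_mem_scalars, of a r x]
    banach_over_mult[OF of_real_mem_scalars, of a r x]
  by (simp add: banach_over_scaleR mult.commute)

text \<open>
  A nonzero continuous functional over the scalar field; in the complex case it is obtained from a
  real functional \<open>\<phi>\<close> as \<open>u \<mapsto> \<phi> u - \<i> \<phi> (\<i> u)\<close>.
\<close>

lemma scalar_functional:
  assumes "u0 \<noteq> 0"
  shows "\<exists>c. c u0 \<noteq> 0 \<and> (\<forall>x. c x \<in> F) \<and> (\<forall>x y. c (x + y) = c x + c y) \<and>
    (\<forall>a\<in>F. \<forall>x. c (sc a x) = a * c x) \<and> (\<forall>x. cmod (c x) \<le> 2 * norm x)"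
proof -
  obtain \<phi> where lin: "linear \<phi>" and le: "\<And>x. \<bar>\<phi> x\<bar> \<le> norm x" and u0: "norm u0 \<le> \<phi> u0"
    using norming_functional[of u0] by blast
  have pos: "\<phi> u0 > 0" using u0 assms by (metis less_le_trans zero_less_norm_iff)
  show ?thesis
  proof (cases "F = UNIV")
    case False
    with F have FR: "F = \<real>" by blast
    show ?thesis
    proof (intro exI[of _ "\<lambda>x. complex_of_real (\<phi> x)"] conjI allI ballI)
      fix a x assume "a \<in> F"
      then obtain r where "a = complex_of_real r" by (auto simp: FR Reals_def)
      then show "complex_of_real (\<phi> (sc a x)) = a * complex_of_real (\<phi> x)"
        by (simp add: banach_over_scaleR linear_scale[OF lin])
    next
      fix x show "cmod (complex_of_real (\<phi> x)) \<le> 2 * norm x"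
        using le[of x] by simp
    qed (use pos in \<open>auto simp: FR linear_add[OF lin]\<close>)
  next
    case True
    define c where "c x = complex_of_real (\<phi> x) - \<i> * complex_of_real (\<phi> (sc \<i> x))" for x
    have i2: "sc \<i> (sc \<i> x) = - x" for x
      using banach_over_mult[of \<i> \<i> x] banach_over_scaleR[of "-1" x] True by simp
    have "c (sc a x) = a * c x" for a x
    proof -
      have sca: "sc a y = Re a *\<^sub>R y + Im a *\<^sub>R sc \<i> y" for y
      proof -
        have "sc a y = sc (complex_of_real (Re a) + complex_of_real (Im a) * \<i>) y"
          by (simp add: complex_eq[symmetric] mult.commute)
        also have "\<dots> = Re a *\<^sub>R y + Im a *\<^sub>R sc \<i> y"
          using True by (simp add: banach_over_add_left banach_over_mult banach_over_scaleR)
        finally show ?thesis .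
      qed
      have "sc \<i> (sc a x) = Re a *\<^sub>R sc \<i> x - Im a *\<^sub>R x"
        using True by (simp add: sca banach_over_add_right banach_over_scaleR_commute i2)
      then have "\<phi> (sc \<i> (sc a x)) = Re a * \<phi> (sc \<i> x) - Im a * \<phi> x"
        by (simp add: linear_diff[OF lin] linear_scale[OF lin])
      moreover have "\<phi> (sc a x) = Re a * \<phi> x + Im a * \<phi> (sc \<i> x)"
        by (simp add: sca linear_add[OF lin] linear_scale[OF lin])
      ultimately show ?thesis by (simp add: c_def complex_eq_iff algebra_simps)
    qed
    moreover have "cmod (c x) \<le> 2 * norm x" for x
    proof -
      have "cmod (c x) \<le> \<bar>\<phi> x\<bar> + \<bar>\<phi> (sc \<i> x)\<bar>"
        unfolding c_def by (rule order_trans[OF norm_triangle_ineq4]) (simp add: norm_mult)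
      also have "\<dots> \<le> norm x + norm (sc \<i> x)" by (intro add_mono le)
      finally show ?thesis using True by (simp add: banach_over_norm)
    qed
    moreover have "c u0 \<noteq> 0" using pos by (auto simp: c_def complex_eq_iff)
    moreover have "c (x + y) = c x + c y" for x y
      using True by (simp add: c_def banach_over_add_right linear_add[OF lin] algebra_simps)
    ultimately show ?thesis using True by (intro exI[of _ c]) auto
  qed
qed

end

lemma subspace_lin_ops:
  assumes F: "F = \<real> \<or> F = UNIV" and V: "banach_over F scV" and W: "banach_over F scW"
  shows "subspace (lin_ops F scV scW)"
  unfolding lin_ops_def subspace_def
  using banach_over_add_right[OF F W] banach_over_zero[OF F W] banach_over_scaleR_commute[OF F W]
  by (auto simp: blinfun.add_left blinfun.scaleR_left)

lemma lin_ops_rank_one: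
  assumes F: "F = \<real> \<or> F = UNIV" and U: "banach_over F scU" and V: "banach_over F scV"
    and u0: "u0 \<noteq> 0"
  shows "\<exists>B \<in> lin_ops F scU scV. blinfun_apply B u0 = v"
proof -
  obtain c where c: "c u0 \<noteq> 0" "\<And>x. c x \<in> F" "\<And>x y. c (x + y) = c x + c y"
    "\<And>a x. a \<in> F \<Longrightarrow> c (scU a x) = a * c x" "\<And>x. cmod (c x) \<le> 2 * norm x"
    using scalar_functional[OF F U u0] by blast
  define k where "k x = c x / c u0" for x
  have kF: "k x \<in> F" for x using c(2)[of x] c(2)[of u0] F by (auto simp: k_def intro: Reals_divide)
  have k_add: "k (x + y) = k x + k y" for x y by (simp add: k_def c add_divide_distrib)
  have k_sc: "k (scU a x) = a * k x" if "a \<in> F" for a x using that by (simp add: k_def c)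
  have bl: "bounded_linear (\<lambda>x. scV (k x) v)"
  proof (rule bounded_linear_intro)
    show "scV (k (x + y)) v = scV (k x) v + scV (k y) v" for x y
      by (simp add: k_add banach_over_add_left[OF F V] kF)
    show "scV (k (r *\<^sub>R x)) v = r *\<^sub>R scV (k x) v" for r x
      using k_sc[OF of_real_mem_scalars[OF F V], of r x]
      by (simp add: banach_over_scaleR[OF F U] banach_over_mult[OF F V] of_real_mem_scalars[OF F V] kF
          banach_over_scaleR[OF F V])
    show "norm (scV (k x) v) \<le> norm x * (2 / cmod (c u0) * norm v)" for x
    proof -
      have "cmod (k x) \<le> 2 * norm x / cmod (c u0)"
        using c(5)[of x] by (simp add: k_def norm_divide divide_right_mono)
      then have "cmod (k x) * norm v \<le> 2 * norm x / cmod (c u0) * norm v"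
        by (rule mult_right_mono) simp
      then show ?thesis by (simp add: banach_over_norm[OF F V kF] mult_ac)
    qed
  qed
  show ?thesis
  proof (intro bexI[of _ "Blinfun (\<lambda>x. scV (k x) v)"])
    have "k u0 = complex_of_real 1" using c(1) by (simp add: k_def)
    then show "blinfun_apply (Blinfun (\<lambda>x. scV (k x) v)) u0 = v"
      using banach_over_scaleR[OF F V, of 1 v] by (simp add: bounded_linear_Blinfun_apply[OF bl])
    show "Blinfun (\<lambda>x. scV (k x) v) \<in> lin_ops F scU scV"
      unfolding lin_ops_def
      by (auto simp: bounded_linear_Blinfun_apply[OF bl] k_sc banach_over_mult[OF F V] kF)
  qed
qed

section \<open>The measure of composition operators\<close>

lemma comp_measure_CA:
  assumes "\<mu> \<in> CA X Y"
  shows "comp_measure \<mu> \<in> CA X UNIV"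
proof -
  define L :: "('b \<Rightarrow>\<^sub>L 'c) \<Rightarrow> ('d \<Rightarrow>\<^sub>L 'b) \<Rightarrow>\<^sub>L ('d \<Rightarrow>\<^sub>L 'c)"
    where "L T = Blinfun (\<lambda>B. T o\<^sub>L B)" for T
  have L: "blinfun_apply (L T) B = T o\<^sub>L B" for T B
    unfolding L_def
    by (simp add: bounded_linear_Blinfun_apply
        bounded_bilinear.bounded_linear_right[OF bounded_bilinear_blinfun_compose])
  have "bounded_linear L"
  proof (rule bounded_linear_intro)
    show "L (S + T) = L S + L T" for S T
      by (intro blinfun_eqI) (simp add: L blinfun.add_left)
    show "L (r *\<^sub>R T) = r *\<^sub>R L T" for r T
      by (intro blinfun_eqI) (simp add: L blinfun.scaleR_left)
    show "norm (L T) \<le> norm T * 1" for T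
      by (rule norm_blinfun_bound) (simp_all add: L norm_blinfun_compose)
  qed
  moreover have "comp_measure \<mu> A = L (\<mu> A)" for A
    by (simp add: comp_measure_def L_def)
  ultimately show ?thesis
    using assms unfolding CA_def by (auto intro: bounded_linear.sums)
qed

lemma semivariation_comp_measure_le:
  "semivariation X E (comp_measure \<mu>) Z \<le> semivariation X UNIV \<mu> Z"
proof -
  let ?S = "semivariation X UNIV \<mu> Z"
  show ?thesis
  proof (cases "?S = \<infinity>")
    case False
    show ?thesis
      unfolding semivariation_def[of X E]
    proof (intro Sup_least, elim CollectE exE conjE, goal_cases)
      case (1 y n B v)
      have "norm (\<Sum>i<n. blinfun_apply (comp_measure \<mu> (B i)) (v i)) \<le> enn2real ?S"
      proof (rule norm_blinfun_bound)
        fix u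
        show "norm (blinfun_apply (\<Sum>i<n. blinfun_apply (comp_measure \<mu> (B i)) (v i)) u)
          \<le> enn2real ?S * norm u"
        proof (cases "u = 0")
          case u: False
          define w where "w i = v i ((1 / norm u) *\<^sub>R u)" for i
          have "norm (w i) \<le> 1" if "i < n" for i
          proof -
            have "norm (w i) \<le> norm (v i) * norm ((1 / norm u) *\<^sub>R u)"
              unfolding w_def by (rule norm_blinfun)
            also have "\<dots> \<le> 1" using 1 u that by simp
            finally show ?thesis .
          qed
          then have "ennreal (norm (\<Sum>i<n. blinfun_apply (\<mu> (B i)) (w i))) \<le> ?S"
            unfolding semivariation_def using 1
            by (intro Sup_upper CollectI exI[of _ n] exI[of _ B] exI[of _ w]) auto
          then have "norm (\<Sum>i<n. blinfun_apply (\<mu> (B i)) (w i)) \<le> enn2real ?S"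
            using False by (metis enn2real_mono enn2real_ennreal infinity_ennreal_def less_top norm_ge_zero)
          moreover have "blinfun_apply (\<Sum>i<n. blinfun_apply (comp_measure \<mu> (B i)) (v i)) u
              = norm u *\<^sub>R (\<Sum>i<n. blinfun_apply (\<mu> (B i)) (w i))"
            using u by (simp add: blinfun.sum_left scaleR_sum_right w_def blinfun.scaleR_right)
          ultimately show ?thesis using u by (simp add: mult.commute mult_right_mono)
        qed simp
      qed simp
      then have "y \<le> ennreal (enn2real ?S)" using 1 by (simp add: ennreal_leI)
      also have "\<dots> = ?S" using False by (simp add: less_top)
      finally show ?case .
    qed
  qed simp
qed

text \<open>
  Testing on rank-one operators shows that null sets of \<open>comp_measure \<mu>\<close> are null sets of \<open>\<mu>\<close>,
  provided that there is a nonzero vector \<open>u0\<close>.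
\<close>

lemma semivariation_comp_measure_eq_0D:
  fixes \<mu> :: "'x set \<Rightarrow> 'v::banach \<Rightarrow>\<^sub>L 'w::banach" and u0 :: "'u::banach"
    and scU :: "complex \<Rightarrow> 'u \<Rightarrow> 'u"
  assumes F: "F = \<real> \<or> F = UNIV" and U: "banach_over F scU" and V: "banach_over F scV"
    and \<mu>: "\<mu> \<in> CA X UNIV" and u0: "u0 \<noteq> 0"
    and null: "semivariation X (lin_ops F scU scV) (comp_measure \<mu>) N = 0"
  shows "semivariation X UNIV \<mu> N = 0"
proof -
  interpret \<mu>: operator_measure X UNIV \<mu>
    using \<mu> by unfold_locales auto
  interpret M: operator_measure X "lin_ops F scU scV" "comp_measure \<mu>"
    using comp_measure_CA[OF \<mu>] subspace_lin_ops[OF F U V] by unfold_locales auto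
  show ?thesis
  proof (rule \<mu>.semivariation_eq_0I)
    fix A v assume A: "A \<in> sets X" "A \<subseteq> N"
    obtain B where B: "B \<in> lin_ops F scU scV" "blinfun_apply B u0 = v"
      using lin_ops_rank_one[OF F U V u0] by blast
    have "\<mu> A o\<^sub>L B = 0" using M.semivariation_0D[OF null A B(1)] by simp
    then have "blinfun_apply (\<mu> A o\<^sub>L B) u0 = 0" by simp
    then show "\<mu> A v = 0" using B by simp
  qed
qed

section \<open>Measures with an operator-valued density\<close>

text \<open>
  The measure \<open>\<gamma>\<close> has the density \<open>g\<close> with respect to \<open>\<mu>\<close>, as witnessed by a sequence \<open>G\<close> of
  simple functions that converges to \<open>g\<close> off the \<open>\<mu>\<close>-null set \<open>N\<close> and whose integrals with
  respect to \<open>comp_measure \<mu>\<close> converge to \<open>\<gamma>\<close> setwise.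
\<close>

locale operator_density = \<mu>: finite_operator_measure X UNIV \<mu>
  for X :: "'x measure" and \<mu> :: "'x set \<Rightarrow> 'v::banach \<Rightarrow>\<^sub>L 'w::banach" +
  fixes g :: "'x \<Rightarrow> 'u::banach \<Rightarrow>\<^sub>L 'v" and \<gamma> :: "'x set \<Rightarrow> 'u \<Rightarrow>\<^sub>L 'w"
    and N :: "'x set" and G :: "nat \<Rightarrow> 'x \<Rightarrow> 'u \<Rightarrow>\<^sub>L 'v"
  assumes \<gamma>_CA: "\<gamma> \<in> CA X UNIV"
    and N: "N \<in> sets X" "semivariation X UNIV \<mu> N = 0"
    and G_simple: "\<And>n. simple_function X (G n)"
    and G_lim: "\<And>x. x \<in> space X - N \<Longrightarrow> (\<lambda>n. G n x) \<longlonglongrightarrow> g x"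
    and G_int: "\<And>A. A \<in> sets X \<Longrightarrow> (\<lambda>n. simple_int X (comp_measure \<mu>) A (G n)) \<longlonglongrightarrow> \<gamma> A"

sublocale operator_density \<subseteq> \<gamma>: operator_measure X UNIV \<gamma>
  by unfold_locales (auto intro: \<gamma>_CA)

context operator_density
begin

lemma simple_function_G_apply:
  "simple_function X s \<Longrightarrow> simple_function X (\<lambda>x. blinfun_apply (G n x) (s x))"
  by (rule simple_function_compose2[OF G_simple])

lemma simple_int_comp_measure_apply:
  assumes "C \<in> sets X"
  shows "simple_int X \<mu> C (\<lambda>x. blinfun_apply (G n x) v)
    = blinfun_apply (simple_int X (comp_measure \<mu>) C (G n)) v"
  by (subst \<mu>.simple_int_refine[OF G_simple _ assms, of _ "\<lambda>B. blinfun_apply B v" n])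
    (simp_all add: simple_int_def blinfun.sum_left)

lemma simple_int_density_tendsto:
  assumes s: "simple_function X s" and A: "A \<in> sets X"
  shows "(\<lambda>n. simple_int X \<mu> A (\<lambda>x. blinfun_apply (G n x) (s x))) \<longlonglongrightarrow> simple_int X \<gamma> A s"
proof -
  let ?S = "\<lambda>v. A \<inter> (s -` {v} \<inter> space X)"
  have S: "?S v \<in> sets X" for v using A simple_functionD(2)[OF s] by blast
  have eq: "simple_int X \<mu> A (\<lambda>x. blinfun_apply (G n x) (s x))
      = (\<Sum>v\<in>s ` space X. blinfun_apply (simple_int X (comp_measure \<mu>) (?S v) (G n)) v)" for n
  proof -
    let ?h = "\<lambda>x. blinfun_apply (G n x) (s x)"
    have "A = (\<Union>v\<in>s ` space X. ?S v)" using sets.sets_into_space[OF A] by auto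
    then have "simple_int X \<mu> A ?h = simple_int X \<mu> (\<Union>v\<in>s ` space X. ?S v) ?h"
      by simp
    also have "\<dots> = (\<Sum>v\<in>s ` space X. simple_int X \<mu> (?S v) ?h)"
      using S simple_functionD(1)[OF s]
      by (intro CA_UN_finite[OF \<mu>.simple_int_CA[OF simple_function_G_apply[OF s]]])
        (auto simp: disjoint_family_on_def)
    also have "\<dots> = (\<Sum>v\<in>s ` space X. simple_int X \<mu> (?S v) (\<lambda>x. blinfun_apply (G n x) v))"
      by (intro sum.cong refl \<mu>.simple_int_cong_on simple_function_G_apply s S simple_function_const)
        auto
    finally show ?thesis by (simp add: simple_int_comp_measure_apply S)
  qed
  show ?thesis
    unfolding eq simple_int_def[of X \<gamma>]
    by (intro tendsto_sum blinfun.tendsto G_int S tendsto_const)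
qed

lemma dobrakov_seq_G_apply:
  assumes s: "simple_function X s"
  shows "dobrakov_seq X UNIV \<mu> (\<lambda>x. blinfun_apply (g x) (s x)) (\<lambda>n x. blinfun_apply (G n x) (s x))"
  unfolding dobrakov_seq_def ae_semivar_def
proof (intro conjI allI ballI bexI[of _ N])
  show "(\<lambda>x. blinfun_apply (G n x) (s x)) \<in> simple_fun X UNIV" for n
    using simple_function_G_apply[OF s] by (simp add: simple_fun_def)
  show "(\<lambda>n. blinfun_apply (G n x) (s x)) \<longlonglongrightarrow> blinfun_apply (g x) (s x)" if "x \<in> space X - N" for x
    by (intro blinfun.tendsto G_lim that tendsto_const)
  show "convergent (\<lambda>n. simple_int X \<mu> A (\<lambda>x. blinfun_apply (G n x) (s x)))" if "A \<in> sets X" for A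
    using simple_int_density_tendsto[OF s that] by (auto simp: convergent_def)
qed (use N in auto)

lemma dobrakov_integral_density_simple:
  assumes "simple_function X s" "A \<in> sets X"
  shows "dobrakov_integral X UNIV \<mu> A (\<lambda>x. blinfun_apply (g x) (s x)) = simple_int X \<gamma> A s"
  using assms
  by (intro \<mu>.dobrakov_integral_eqI[OF dobrakov_seq_G_apply _ simple_int_density_tendsto])

lemma density_null:
  assumes "semivariation X UNIV \<mu> Z = 0"
  shows "semivariation X UNIV \<gamma> Z = 0"
proof (rule \<gamma>.semivariation_eq_0I)
  fix A v assume A: "A \<in> sets X" "A \<subseteq> Z"
  have "(\<lambda>n. simple_int X \<mu> A (\<lambda>x. blinfun_apply (G n x) v)) \<longlonglongrightarrow> simple_int X \<gamma> A (\<lambda>_. v)"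
    by (rule simple_int_density_tendsto[OF simple_function_const A(1)])
  moreover have "simple_int X \<mu> A (\<lambda>x. blinfun_apply (G n x) v) = 0" for n
    using simple_function_G_apply[OF simple_function_const]
    by (intro \<mu>.simple_int_null[OF _ A assms]) (simp add: simple_fun_def)
  ultimately show "\<gamma> A v = 0" using A by (simp add: \<gamma>.simple_int_const LIMSEQ_const_iff)
qed

end

text \<open>
  The semivariation of \<open>\<gamma>\<close> may be infinite, but it is finite on each of the sets where the \<open>G n\<close>
  are bounded by a common constant, and these sets exhaust the space up to \<open>N\<close>.
\<close>

sublocale operator_density \<subseteq> \<gamma>: sigma_finite_operator_measure X UNIV \<gamma>
proof
  define Y where "Y j = {x\<in>space X - N. \<forall>n\<ge>0. norm (G n x) \<le> real (Suc j)}" for j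
  have Ys: "Y j \<in> sets X" for j
    unfolding Y_def using N
    by (intro sets_Collect_all_ge sets_Collect_simple_function G_simple) auto
  have fin: "semivariation X UNIV \<gamma> (Y j) < \<infinity>" for j
  proof -
    let ?K = "real (Suc j) * enn2real (semivariation X UNIV \<mu> (space X))"
    have "semivariation X UNIV \<gamma> (Y j) \<le> ennreal ?K"
    proof (rule \<gamma>.semivariation_leI[OF Ys])
      fix A and s :: "'x \<Rightarrow> 'u"
      assume A: "A \<in> sets X" "A \<subseteq> Y j" and s: "s \<in> simple_fun X UNIV" and s1: "\<And>x. norm (s x) \<le> 1"
      have sf: "simple_function X s" using s by (rule simple_fun_simple_function)
      have "norm (simple_int X \<mu> A (\<lambda>x. blinfun_apply (G n x) (s x))) \<le> ?K" for n
      proof (rule \<mu>.simple_int_bound[OF _ A(1) sets.sets_into_space[OF A(1)] _ _ \<mu>.finite])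
        show "(\<lambda>x. blinfun_apply (G n x) (s x)) \<in> simple_fun X UNIV"
          using simple_function_G_apply[OF sf] by (simp add: simple_fun_def)
        fix x assume "x \<in> A"
        then have "norm (G n x) \<le> real (Suc j)" using A by (auto simp: Y_def)
        then have "norm (G n x) * norm (s x) \<le> real (Suc j) * 1" using s1 by (intro mult_mono) auto
        then show "norm (blinfun_apply (G n x) (s x)) \<le> real (Suc j)"
          using order_trans[OF norm_blinfun] by simp
      qed simp
      then have "norm (simple_int X \<gamma> A s) \<le> ?K"
        by (intro LIMSEQ_le_const2[OF tendsto_norm[OF simple_int_density_tendsto[OF sf A(1)]]]) auto
      then show "ennreal (norm (simple_int X \<gamma> A s)) \<le> ennreal ?K" by (rule ennreal_leI)
    qed
    then show ?thesis by (simp add: le_less_trans)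
  qed
  have "space X - (\<Union>j. Y j) \<subseteq> N"
  proof
    fix x assume x: "x \<in> space X - (\<Union>j. Y j)"
    show "x \<in> N"
    proof (rule ccontr)
      assume "x \<notin> N"
      then have "convergent (\<lambda>n. G n x)" using x G_lim[of x] by (auto simp: convergent_def)
      then have "Bseq (\<lambda>n. G n x)" by (rule convergent_imp_Bseq)
      then obtain K where "\<And>n. norm (G n x) \<le> real (Suc K)" unfolding Bseq_iff by blast
      with x \<open>x \<notin> N\<close> show False by (auto simp: Y_def)
    qed
  qed
  from semivariation_mono[OF this, of X UNIV \<gamma>] have "semivariation X UNIV \<gamma> (space X - (\<Union>j. Y j)) = 0"
    using density_null[OF N(2)] by simp
  moreover have "incseq Y"
  proof (rule incseq_SucI, rule subsetI)
    fix j x assume x: "x \<in> Y j"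
    have "norm (G n x) \<le> real (Suc (Suc j))" for n
    proof -
      have "norm (G n x) \<le> real (Suc j)" using x by (auto simp: Y_def)
      also have "\<dots> \<le> real (Suc (Suc j))" by simp
      finally show ?thesis .
    qed
    with x show "x \<in> Y (Suc j)" by (simp add: Y_def)
  qed
  ultimately show "\<exists>Y::nat \<Rightarrow> 'x set. range Y \<subseteq> sets X \<and> incseq Y \<and>
    (\<forall>j. semivariation X UNIV \<gamma> (Y j) < \<infinity>) \<and> semivariation X UNIV \<gamma> (space X - (\<Union>j. Y j)) = 0"
    using Ys fin by (intro exI[of _ Y]) auto
qed

lemma ennreal_le_ennreal_powr_iff:
  "a \<ge> 0 \<Longrightarrow> b \<ge> 0 \<Longrightarrow> ennreal a \<le> ennreal_powr (ennreal b) p \<longleftrightarrow> a \<le> b powr p"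
  by (simp add: ennreal_powr_def ennreal_le_iff)

lemma ennreal_powr_mono:
  assumes "ennreal a \<le> S" "0 \<le> a" "0 \<le> q"
  shows "ennreal (a powr q) \<le> ennreal_powr S q"
proof (cases "S = \<infinity>")
  case False
  then have "a \<le> enn2real S"
    using assms by (metis enn2real_ennreal enn2real_mono infinity_ennreal_def less_top)
  with False assms show ?thesis by (simp add: ennreal_powr_def ennreal_leI powr_mono2)
qed (simp add: ennreal_powr_def)

context operator_density
begin

lemma p_semivar_density:
  assumes A: "A \<in> sets X"
  shows "p_semivar X UNIV \<gamma> p f A =
    Sup {ennreal (norm (dobrakov_integral X UNIV \<mu> A (\<lambda>x. blinfun_apply (g x) (s x))) powr (1 / p)) | s.
      s \<in> simple_fun X UNIV \<and> (\<forall>x\<in>space X. norm (s x) \<le> norm (f x) powr p)}"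
  unfolding p_semivar_def p_semivar_ennreal_def
  by (rule arg_cong[where f = Sup], intro Collect_cong ex_cong1)
    (auto simp: ennreal_le_ennreal_powr_iff dobrakov_integral_density_simple A simple_fun_def)

lemma p_semivar_density_le:
  assumes A: "A \<in> sets X" and p: "p > 0"
  shows "p_semivar X UNIV \<gamma> p f A \<le>
    ennreal_powr (p_semivar_ennreal X UNIV \<mu> 1 (\<lambda>x. ennreal (norm (g x) * norm (f x) powr p)) A) (1 / p)"
  unfolding p_semivar_density[OF A]
proof (intro Sup_least, elim CollectE exE conjE)
  fix y s
  let ?I = "dobrakov_integral X UNIV \<mu> A (\<lambda>x. blinfun_apply (g x) (s x))"
  assume y: "y = ennreal (norm ?I powr (1 / p))" and s: "s \<in> simple_fun X UNIV"
    and le: "\<forall>x\<in>space X. norm (s x) \<le> norm (f x) powr p"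
  have "ennreal (norm ?I)
      \<le> p_semivar_ennreal X UNIV \<mu> 1 (\<lambda>x. ennreal (norm (g x) * norm (f x) powr p)) A"
  proof (rule \<mu>.norm_dobrakov_integral_le[OF dobrakov_seq_G_apply[OF simple_fun_simple_function[OF s]] A])
    fix x assume "x \<in> space X"
    with le have "norm (g x) * norm (s x) \<le> norm (g x) * norm (f x) powr p"
      by (intro mult_left_mono) auto
    then show "ennreal (norm (blinfun_apply (g x) (s x))) \<le> ennreal (norm (g x) * norm (f x) powr p)"
      by (meson ennreal_leI norm_blinfun order_trans)
  qed
  with p show "y \<le> ennreal_powr
      (p_semivar_ennreal X UNIV \<mu> 1 (\<lambda>x. ennreal (norm (g x) * norm (f x) powr p)) A) (1 / p)"
    unfolding y by (intro ennreal_powr_mono) auto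
qed

text \<open>
  The simple functions \<open>s n\<close> approximate \<open>f\<close> and the simple functions \<open>h n\<close> approximate
  \<open>g[f]\<close>, both from below in norm. Interleaving \<open>h n\<close> with \<open>g[s n]\<close> gives one dominated sequence,
  whose integrals converge; hence both kinds of integrals have the same limit.
\<close>

lemma dobrakov_integral_density:
  assumes f: "f \<in> SM X (semivariation X UNIV \<mu>) UNIV"
    and L1: "(\<lambda>x. ennreal (norm (g x) * norm (f x))) \<in> Lp_space_ennreal X UNIV \<mu> 1"
  shows "f \<in> Lp_space X UNIV \<gamma> 1" and "dobrakov_integrable X UNIV \<gamma> f"
    and "dobrakov_integrable X UNIV \<mu> (\<lambda>x. blinfun_apply (g x) (f x))"
    and "A \<in> sets X \<Longrightarrow> dobrakov_integral X UNIV \<gamma> A f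
      = dobrakov_integral X UNIV \<mu> A (\<lambda>x. blinfun_apply (g x) (f x))"
proof -
  let ?gf = "\<lambda>x. blinfun_apply (g x) (f x)"
  define \<phi> where "\<phi> x = ennreal (norm (g x) * norm (f x))" for x
  have \<phi>: "(\<lambda>n. p_semivar_ennreal X UNIV \<mu> 1 \<phi> (A n)) \<longlonglongrightarrow> 0"
    if "range A \<subseteq> sets X" "decseq A" "(\<Inter>n. A n) = {}" for A :: "nat \<Rightarrow> 'x set"
    using L1 that unfolding Lp_space_ennreal_def \<phi>_def[abs_def] by blast
  obtain f0 N1 where f0: "\<And>n::nat. f0 n \<in> simple_fun X UNIV"
    and N1: "N1 \<in> sets X" "semivariation X UNIV \<mu> N1 = 0"
    and f0_lim: "\<And>x. x \<in> space X - N1 \<Longrightarrow> (\<lambda>n. f0 n x) \<longlonglongrightarrow> f x"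
    using f unfolding SM_def ae_semivar_def by blast
  define N0 where "N0 = N \<union> N1"
  have N0: "N0 \<in> sets X" "semivariation X UNIV \<mu> N0 = 0"
    unfolding N0_def using N N1 by (auto intro: \<mu>.semivariation_Un_null)
  have f0_lim': "(\<lambda>n. f0 n x) \<longlonglongrightarrow> f x" if "x \<in> space X - N0" for x
    using that by (intro f0_lim) (auto simp: N0_def)
  have G_lim': "(\<lambda>n. G n x) \<longlonglongrightarrow> g x" if "x \<in> space X - N0" for x
    using that by (intro G_lim) (auto simp: N0_def)
  obtain s where s: "\<And>n::nat. s n \<in> simple_fun X UNIV"
    "\<And>n x. x \<in> space X \<Longrightarrow> norm (s n x) \<le> norm (f x)"
    "\<And>x. x \<in> space X - N0 \<Longrightarrow> (\<lambda>n. s n x) \<longlonglongrightarrow> f x"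
    using simple_approximation_below[OF subspace_UNIV N0(1) f0 f0_lim'] by blast
  have s_sf: "simple_function X (s n)" for n using s(1) by (rule simple_fun_simple_function)
  obtain h where h: "\<And>n::nat. h n \<in> simple_fun X UNIV"
    "\<And>n x. x \<in> space X \<Longrightarrow> norm (h n x) \<le> norm (?gf x)"
    "\<And>x. x \<in> space X - N0 \<Longrightarrow> (\<lambda>n. h n x) \<longlonglongrightarrow> ?gf x"
  proof -
    let ?f1 = "\<lambda>n x. blinfun_apply (G n x) (f0 n x)"
    have 1: "?f1 n \<in> simple_fun X UNIV" for n
      using simple_function_G_apply[OF simple_fun_simple_function[OF f0]] by (simp add: simple_fun_def)
    have 2: "(\<lambda>n. ?f1 n x) \<longlonglongrightarrow> ?gf x" if "x \<in> space X - N0" for x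
      by (intro blinfun.tendsto f0_lim' G_lim' that)
    from simple_approximation_below[OF subspace_UNIV N0(1), of ?f1, OF 1 2] show thesis
      using that by blast
  qed
  define r where "r n = (if even n then h (n div 2) else (\<lambda>x. blinfun_apply (g x) (s (n div 2) x)))"
    for n
  define t where "t n = (if even n then (\<lambda>_. h (n div 2))
      else (\<lambda>i x. blinfun_apply (G i x) (s (n div 2) x)))" for n
  have Cauchy: "Cauchy (\<lambda>n. dobrakov_integral X UNIV \<mu> A (r n))" if A: "A \<in> sets X" for A
  proof (rule \<mu>.dobrakov_integral_dominated_Cauchy[OF N0 _ _ _ _ \<phi> A])
    show "dobrakov_seq X UNIV \<mu> (r n) (t n)" for n
      using \<mu>.dobrakov_seq_simple[OF h(1)] dobrakov_seq_G_apply[OF s_sf]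
      by (simp add: r_def t_def)
    show "(\<lambda>i. t n i x) \<longlonglongrightarrow> r n x" if "x \<in> space X - N0" for n x
      using that by (auto simp: r_def t_def intro!: blinfun.tendsto G_lim')
    show "(\<lambda>n. r n x) \<longlonglongrightarrow> ?gf x" if x: "x \<in> space X - N0" for x
    proof -
      have half: "filterlim (\<lambda>n::nat. n div 2) sequentially sequentially"
        by (rule filterlim_at_top_div_const_nat) simp
      have "(\<lambda>n. h (n div 2) x) \<longlonglongrightarrow> ?gf x"
        by (rule filterlim_compose[OF h(3)[OF x] half])
      moreover have "(\<lambda>n. blinfun_apply (g x) (s (n div 2) x)) \<longlonglongrightarrow> ?gf x"
        by (intro blinfun.tendsto tendsto_const filterlim_compose[OF s(3)[OF x] half])
      ultimately show ?thesis
        unfolding r_def if_distribR by (intro filterlim_If) (auto intro: tendsto_mono[OF inf_le1])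
    qed
    show "ennreal (norm (r n x)) \<le> \<phi> x" if x: "x \<in> space X" for n x
    proof -
      have "norm (h k x) \<le> norm (g x) * norm (f x)" for k
        using h(2)[OF x, of k] norm_blinfun[of "g x" "f x"] by linarith
      moreover have "norm (blinfun_apply (g x) (s k x)) \<le> norm (g x) * norm (f x)" for k
        using s(2)[OF x, of k] norm_blinfun[of "g x" "s k x"]
        by (meson mult_left_mono norm_ge_zero order_trans)
      ultimately show ?thesis by (auto simp: r_def \<phi>_def intro!: ennreal_leI)
    qed
  qed
  have lims: "\<exists>L. (\<lambda>n. simple_int X \<mu> A (h n)) \<longlonglongrightarrow> L \<and> (\<lambda>n. simple_int X \<gamma> A (s n)) \<longlonglongrightarrow> L"
    if A: "A \<in> sets X" for A
  proof -
    obtain L where L: "(\<lambda>n. dobrakov_integral X UNIV \<mu> A (r n)) \<longlonglongrightarrow> L"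
      using Cauchy_convergent[OF Cauchy[OF A]] by (auto simp: convergent_def)
    have "strict_mono (\<lambda>n::nat. 2 * n)" "strict_mono (\<lambda>n::nat. 2 * n + 1)"
      by (auto simp: strict_mono_def)
    from this[THEN LIMSEQ_subseq_LIMSEQ[OF L]]
    have "(\<lambda>n. dobrakov_integral X UNIV \<mu> A (h n)) \<longlonglongrightarrow> L"
      "(\<lambda>n. dobrakov_integral X UNIV \<mu> A (\<lambda>x. blinfun_apply (g x) (s n x))) \<longlonglongrightarrow> L"
      by (simp_all add: o_def r_def)
    then show ?thesis
      using A by (auto simp: \<mu>.dobrakov_integral_simple[OF h(1)] dobrakov_integral_density_simple[OF s_sf])
  qed
  then have lim_\<mu>: "\<exists>L. (\<lambda>n. simple_int X \<mu> A (h n)) \<longlonglongrightarrow> L"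
    and lim_\<gamma>: "\<exists>L. (\<lambda>n. simple_int X \<gamma> A (s n)) \<longlonglongrightarrow> L" if "A \<in> sets X" for A
    using that by blast+
  have seq_\<mu>: "dobrakov_seq X UNIV \<mu> ?gf h"
    unfolding dobrakov_seq_def ae_semivar_def convergent_def
    using h N0 lim_\<mu> by (auto intro!: bexI[of _ N0])
  have seq_\<gamma>: "dobrakov_seq X UNIV \<gamma> f s"
    unfolding dobrakov_seq_def ae_semivar_def convergent_def
    using s N0 density_null lim_\<gamma> by (auto intro!: bexI[of _ N0])
  show "dobrakov_integrable X UNIV \<gamma> f" "dobrakov_integrable X UNIV \<mu> ?gf"
    using seq_\<mu> seq_\<gamma> by (auto simp: dobrakov_integrable_def)
  show "dobrakov_integral X UNIV \<gamma> A f = dobrakov_integral X UNIV \<mu> A ?gf" if A: "A \<in> sets X"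
    using lims[OF A] \<mu>.dobrakov_integral_eqI[OF seq_\<mu> A] \<gamma>.dobrakov_integral_eqI[OF seq_\<gamma> A] by metis
  show "f \<in> Lp_space X UNIV \<gamma> 1"
    unfolding Lp_space_def
  proof (intro CollectI conjI allI impI)
    show "f \<in> SM X (semivariation X UNIV \<gamma>) UNIV"
      using seq_\<gamma> by (auto simp: SM_def dobrakov_seq_def)
    fix A :: "nat \<Rightarrow> 'x set"
    assume A: "range A \<subseteq> sets X" "decseq A" "(\<Inter>n. A n) = {}"
    show "(\<lambda>n. p_semivar X UNIV \<gamma> 1 f (A n)) \<longlonglongrightarrow> 0"
    proof (rule tendsto_sandwich[OF _ _ tendsto_const \<phi>[OF A]])
      show "\<forall>\<^sub>F n in sequentially. p_semivar X UNIV \<gamma> 1 f (A n) \<le> p_semivar_ennreal X UNIV \<mu> 1 \<phi> (A n)"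
      proof (intro always_eventually allI)
        fix n
        have "A n \<in> sets X" using A(1) by auto
        from p_semivar_density_le[OF this, of 1 f]
        show "p_semivar X UNIV \<gamma> 1 f (A n) \<le> p_semivar_ennreal X UNIV \<mu> 1 \<phi> (A n)"
          by (simp add: \<phi>_def[abs_def])
      qed
    qed simp
  qed
qed

end

theorem theorem2p5p4:
  fixes X :: "'x measure"
    and F :: "complex set"
    and scV :: "complex \<Rightarrow> 'v::banach \<Rightarrow> 'v"
    and scU :: "complex \<Rightarrow> 'u::banach \<Rightarrow> 'u"
    and scW :: "complex \<Rightarrow> 'w::banach \<Rightarrow> 'w"
    and \<mu> :: "'x set \<Rightarrow> 'v \<Rightarrow>\<^sub>L 'w"
    and g :: "'x \<Rightarrow> 'u \<Rightarrow>\<^sub>L 'v"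
    and \<gamma> :: "'x set \<Rightarrow> 'u \<Rightarrow>\<^sub>L 'w"
    and f :: "'x \<Rightarrow> 'u"
    and p :: real
  assumes "F = \<real> \<or> F = UNIV"
    and "banach_over F scV" and "banach_over F scU" and "banach_over F scW"
    and "\<mu> \<in> CA X (lin_ops F scV scW)"
    and "semivariation X UNIV \<mu> (space X) < \<infinity>"
    and "dobrakov_integrable X (lin_ops F scU scV) (comp_measure \<mu>) g"
    and "\<gamma> \<in> CA X (lin_ops F scU scW)"
    and "\<forall>A\<in>sets X. \<gamma> A = dobrakov_integral X (lin_ops F scU scV) (comp_measure \<mu>) A g"
    and "f \<in> SM X (semivariation X UNIV \<mu>) UNIV"
    and "1 \<le> p"
  shows
    "(\<forall>A\<in>sets X. p_semivar X UNIV \<gamma> p f A =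
        Sup {ennreal (norm (dobrakov_integral X UNIV \<mu> A (\<lambda>x. blinfun_apply (g x) (s x)))
               powr (1 / p)) | s.
             s \<in> simple_fun X UNIV \<and> (\<forall>x\<in>space X. norm (s x) \<le> norm (f x) powr p)})
     \<and> (\<forall>A\<in>sets X. p_semivar X UNIV \<gamma> p f A \<le>
          ennreal_powr
            (p_semivar_ennreal X UNIV \<mu> 1 (\<lambda>x. ennreal (norm (g x) * norm (f x) powr p)) A)
            (1 / p))
     \<and> ((\<lambda>x. ennreal (norm (g x) * norm (f x))) \<in> Lp_space_ennreal X UNIV \<mu> 1 \<longrightarrow>
          f \<in> Lp_space X UNIV \<gamma> 1 \<and>
          dobrakov_integrable X UNIV \<gamma> f \<and>
          dobrakov_integrable X UNIV \<mu> (\<lambda>x. blinfun_apply (g x) (f x)) \<and>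
          (\<forall>A\<in>sets X. dobrakov_integral X UNIV \<gamma> A f =
             dobrakov_integral X UNIV \<mu> A (\<lambda>x. blinfun_apply (g x) (f x))))"
proof -
  let ?E = "lin_ops F scU scV" and ?M = "comp_measure \<mu> :: 'x set \<Rightarrow> ('u \<Rightarrow>\<^sub>L 'v) \<Rightarrow>\<^sub>L ('u \<Rightarrow>\<^sub>L 'w)"
  have \<mu>: "\<mu> \<in> CA X UNIV" and \<gamma>: "\<gamma> \<in> CA X UNIV" using assms(5,8) by (auto simp: CA_def)
  interpret \<mu>: finite_operator_measure X UNIV \<mu>
    using \<mu> assms(6) by unfold_locales auto
  interpret M: finite_operator_measure X ?E ?M
  proof
    show "subspace ?E" using assms(1-3) by (intro subspace_lin_ops)
    show "?M \<in> CA X UNIV" by (rule comp_measure_CA[OF \<mu>])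
    show "semivariation X ?E ?M (space X) < \<infinity>"
      using semivariation_comp_measure_le assms(6) by (rule le_less_trans)
  qed
  obtain G where G: "dobrakov_seq X ?E ?M g G"
    using assms(7) by (auto simp: dobrakov_integrable_def)
  obtain N0 where N0: "N0 \<in> sets X" "semivariation X ?E ?M N0 = 0"
    "\<And>x. x \<in> space X - N0 \<Longrightarrow> (\<lambda>n. G n x) \<longlonglongrightarrow> g x"
    using G unfolding dobrakov_seq_def ae_semivar_def by blast
  obtain N where N: "N \<in> sets X" "semivariation X UNIV \<mu> N = 0"
    "\<And>x. x \<in> space X - N \<Longrightarrow> (\<lambda>n. G n x) \<longlonglongrightarrow> g x"
  proof (cases "\<exists>u0::'u. u0 \<noteq> 0")
    case True
    then have "semivariation X UNIV \<mu> N0 = 0"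
      using semivariation_comp_measure_eq_0D[OF assms(1,3,2) \<mu> _ N0(2)] by blast
    with N0 that show thesis by blast
  next
    case False
    \<comment> \<open>Over the zero space there is only one operator, so \<open>G n = g\<close> everywhere.\<close>
    then have "G n x = g x" for n x
      by (intro blinfun_eqI) (metis blinfun.zero_right)
    then show thesis
      by (intro that[of "{}"]) (auto intro!: \<mu>.semivariation_eq_0I simp: CA_empty[OF \<mu>])
  qed
  interpret operator_density X \<mu> g \<gamma> N G
  proof
    show "\<gamma> \<in> CA X UNIV" by (rule \<gamma>)
    show "simple_function X (G n)" for n
      using G by (auto simp: dobrakov_seq_def simple_fun_def)
    show "(\<lambda>n. simple_int X ?M A (G n)) \<longlonglongrightarrow> \<gamma> A" if "A \<in> sets X" for A
      using M.dobrakov_integral_tendsto[OF G that] assms(9) that by simp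
  qed (use N in auto)
  show ?thesis
    using p_semivar_density[of _ p f] p_semivar_density_le[of _ p f] assms(11)
      dobrakov_integral_density[OF assms(10)]
    by auto
qed

end
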